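(* Let $B : [0,1] \to [0,+\infty)$ be a $C^1$ function such that $B(0)=B(1)=0$, $B(u)>0$ for all $u \in (0,1)$, and $B'(0)>0>B'(1)$. Let $b:=B'$. Then for all $\overline\mu \in \overline{\mathcal{P}}(\mathbb{R})$ and for all $\mu \in \mathcal{P}(\mathbb{R})$ such that $\rho(\mu)=\overline\mu$, \[ \overline{\mathscr{I}}[\overline\mu] = \mathscr{R}[\mu|\widetilde\mu_\infty] + \frac{2}{\sigma^2}\int_{x\in\mathbb{R}} \Gamma\left(F_\mu(x),F_{\widetilde\mu_\infty}(x)\right)\mathrm{d}x, \] where \[ \Gamma(u,v) := B(u)-B(v)-b(v)(u-v). \] As a consequence, if $B$ is concave, then for all $\overline\mu \in \overline{\mathcal{P}}(\mathbb{R})$, \[ \overline{\mathscr{I}}[\overline\mu] \leq \overline{\mathscr{I}}_\infty[\overline\mu]. \]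
   Context: $\sigma^2>0$ is fixed. $\mathcal{P}(\mathbb{R})$ is the set of Borel probability measures on $\mathbb{R}$, $\mathcal{P}_1(\mathbb{R})$ the set of those with finite first moment, and $F_\mu$ is the cumulative distribution function of $\mu$. For $y \in \mathbb{R}$, $\tau_y\mu$ is the pushforward of $\mu$ by $x \mapsto x+y$; $\overline{\mathcal{P}}(\mathbb{R})$ is the orbit space of the action $(y,\mu)\mapsto\tau_y\mu$ of $\mathbb{R}$ on $\mathcal{P}(\mathbb{R})$, and $\rho(\mu)=\{\tau_y\mu : y\in\mathbb{R}\}$ is the orbit map. The energy functional associated with $B$ is $\mathscr{W}[\mu] = \int_{\mathbb{R}} B(F_\mu(x))\,\mathrm{d}x$. The entropy is $\mathscr{S}[\mu] := \int_{\mathbb{R}} p(x)\log p(x)\,\mathrm{d}x \in (-\infty,+\infty]$ if $\mu \in \mathcal{P}_1(\mathbb{R})$ has density $p$ with respect to the Lebesgue measure, and $\mathscr{S}[\mu]:=+\infty$ otherwise. The free energy is $\mathscr{F}[\mu] := \mathscr{S}[\mu]+\frac{2}{\sigma^2}\mathscr{W}[\mu]$, $\mathscr{F}_\star := \inf_{\mu\in\mathcal{P}(\mathbb{R})}\mathscr{F}[\mu]$ (which is finite), and $\overline{\mathscr{I}}[\rho(\mu)]:=\mathscr{F}[\mu]-\mathscr{F}_\star$, which is well defined on $\overline{\mathcal{P}}(\mathbb{R})$ by translation invariance of $\mathscr{F}$. $\widetilde\mu_\infty$ denotes the unique centered (mean zero) stationary measure of the nonlinear diffusion process describing the mean-field limit,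 as $n\to+\infty$, of the system of rank-based interacting diffusions $\mathrm{d}X_i(t)=\sum_{k=1}^n b_n(k)\mathbf{1}_{\{X_i(t)=X_{(k)}(t)\}}\mathrm{d}t+\sigma\,\mathrm{d}\beta_i(t)$, $1\le i\le n$, where $\beta_1,\ldots,\beta_n$ are independent standard Brownian motions, $X_{(1)}(t)\leq\cdots\leq X_{(n)}(t)$ are the order statistics and $b_n(k)=n(B(k/n)-B((k-1)/n))$ (existence and uniqueness of $\widetilde\mu_\infty$ under the present assumptions on $B$ are known). It satisfies the stationary nonlinear Fokker--Planck equation $0=\frac{\sigma^2}{2}\partial_{xx}\widetilde\mu_\infty-\partial_x(b(F_{\widetilde\mu_\infty})\widetilde\mu_\infty)$, and has a Lebesgue density $\widetilde p_\infty$ satisfying $\widetilde p_\infty(x)=\frac{1}{\widetilde z_\infty}\exp\left(\frac{2}{\sigma^2}\int_0^x b(F_{\widetilde\mu_\infty}(y))\,\mathrm{d}y\right)$, with $\widetilde z_\infty$ the normalising constant. Relative entropy: $\mathscr{R}[\mu|\nu] := \int_{\mathbb{R}} \frac{\mathrm{d}\mu}{\mathrm{d}\nu}\log\left(\frac{\mathrm{d}\mu}{\mathrm{d}\nu}\right)\mathrm{d}\nu$ if $\mu\ll\nu$, and $+\infty$ otherwise. Finally, $\overline{\mathscr{I}}_\infty[\overline\mu] := \inf_{\mu\in\mathcal{P}(\mathbb{R}):\rho(\mu)=\overline\mu}\mathscr{R}[\mu|\widetilde\mu_\infty]$. *)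

theory Defs
  imports "HOL-Probability.Probability"
begin

(* Integral with values in [-oo,+oo]: positive part minus negative part.
   In ereal, oo - oo = oo and oo + (-oo) = oo. This matters for a probability measure
   without first moment: both its free energy and its relative entropy with respect to the
   stationary measure are oo, while the integral of Gamma_B may be -oo; the sum of the last
   two is then read as oo. *)
definition ext_integral :: "'a measure \<Rightarrow> ('a \<Rightarrow> real) \<Rightarrow> ereal" where
  "ext_integral M f =
     enn2ereal (\<integral>\<^sup>+x. ennreal (f x) \<partial>M) - enn2ereal (\<integral>\<^sup>+x. ennreal (- f x) \<partial>M)"

definition borel_probs :: "real measure set" where
  "borel_probs = {\<mu>. real_distribution \<mu>}"

definition translate :: "real \<Rightarrow> real measure \<Rightarrow> real measure" where
  "translate y \<mu> = distr \<mu> borel (\<lambda>x. x + y)"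

definition orbit_map :: "real measure \<Rightarrow> real measure set" where
  "orbit_map \<mu> = range (\<lambda>y. translate y \<mu>)"

definition orbit_space :: "real measure set set" where
  "orbit_space = orbit_map ` borel_probs"

definition energy :: "(real \<Rightarrow> real) \<Rightarrow> real measure \<Rightarrow> ereal" where
  "energy B \<mu> = ext_integral lborel (\<lambda>x. B (cdf \<mu> x))"

(* The sign convention is that of statistical physics, +p log p, opposite to
   prob_space.entropy. The convention 0 log 0 = 0 holds since 0 * ln 0 = 0. The first
   moment condition makes the negative part of p log p integrable. *)
definition boltzmann_entropy :: "real measure \<Rightarrow> ereal" where
  "boltzmann_entropy \<mu> =
     (if integrable \<mu> (\<lambda>x. x) \<and> absolutely_continuous lborel \<mu>
      then ext_integral lborel
             (\<lambda>x. enn2real (RN_deriv lborel \<mu> x) * ln (enn2real (RN_deriv lborel \<mu> x)))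
      else \<infinity>)"

definition free_energy :: "real \<Rightarrow> (real \<Rightarrow> real) \<Rightarrow> real measure \<Rightarrow> ereal" where
  "free_energy \<sigma> B \<mu> = boltzmann_entropy \<mu> + ereal (2 / \<sigma>\<^sup>2) * energy B \<mu>"

definition min_free_energy :: "real \<Rightarrow> (real \<Rightarrow> real) \<Rightarrow> ereal" where
  "min_free_energy \<sigma> B = (INF \<mu>\<in>borel_probs. free_energy \<sigma> B \<mu>)"

(* The function induced on orbits: an orbit is the set of its representatives, and by
   translation invariance the image below is a singleton. *)
definition orbit_rate :: "real \<Rightarrow> (real \<Rightarrow> real) \<Rightarrow> real measure set \<Rightarrow> ereal" where
  "orbit_rate \<sigma> B A = the_elem ((\<lambda>\<mu>. free_energy \<sigma> B \<mu> - min_free_energy \<sigma> B) ` A)"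

(* KL_divergence is real valued, hence unusable when the integral diverges. *)
definition relative_entropy :: "real measure \<Rightarrow> real measure \<Rightarrow> ereal" where
  "relative_entropy \<mu> \<nu> =
     (if absolutely_continuous \<nu> \<mu>
      then ext_integral \<nu>
             (\<lambda>x. enn2real (RN_deriv \<nu> \<mu> x) * ln (enn2real (RN_deriv \<nu> \<mu> x)))
      else \<infinity>)"

definition orbit_relative_entropy :: "real measure \<Rightarrow> real measure set \<Rightarrow> ereal" where
  "orbit_relative_entropy \<nu> A =
     (INF \<mu>\<in>{\<mu>\<in>borel_probs. orbit_map \<mu> = A}. relative_entropy \<mu> \<nu>)"

definition Gamma_B :: "(real \<Rightarrow> real) \<Rightarrow> (real \<Rightarrow> real) \<Rightarrow> real \<Rightarrow> real \<Rightarrow> real" where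
  "Gamma_B B b u v = B u - B v - b v * (u - v)"

(* The values of \<beta> at negative times are irrelevant. *)
definition brownian_motion :: "'w measure \<Rightarrow> (real \<Rightarrow> 'w \<Rightarrow> real) \<Rightarrow> bool" where
  "brownian_motion \<Omega> \<beta> \<longleftrightarrow>
     prob_space \<Omega> \<and>
     (\<forall>t\<ge>0. \<beta> t \<in> borel_measurable \<Omega>) \<and>
     (AE \<omega> in \<Omega>. \<beta> 0 \<omega> = 0 \<and> continuous_on {0..} (\<lambda>t. \<beta> t \<omega>)) \<and>
     (\<forall>s t. 0 \<le> s \<and> s < t \<longrightarrow>
        distributed \<Omega> lborel (\<lambda>\<omega>. \<beta> t \<omega> - \<beta> s \<omega>) (normal_density 0 (sqrt (t - s)))) \<and>
     (\<forall>(\<tau> :: nat \<Rightarrow> real) n. 0 \<le> \<tau> 0 \<and> mono \<tau> \<longrightarrow>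
        prob_space.indep_vars \<Omega> (\<lambda>_. borel) (\<lambda>i \<omega>. \<beta> (\<tau> (Suc i)) \<omega> - \<beta> (\<tau> i) \<omega>) {..<n})"

(* The nonlinear diffusion (in the sense of McKean)
     dX(t) = b(F_{P_t}(X(t))) dt + sigma dbeta(t),   P_t the law of X(t),
   which is the mean-field limit of the rank-based system: the drift b_n(k) of the particle
   of rank k is a discretisation of b(k/n), and k/n is the empirical distribution function
   at that particle. The noise being additive, the equation is written in integrated form
   without a stochastic integral. *)
definition nonlinear_diffusion ::
    "real \<Rightarrow> (real \<Rightarrow> real) \<Rightarrow> 'w measure \<Rightarrow> (real \<Rightarrow> 'w \<Rightarrow> real) \<Rightarrow> (real \<Rightarrow> 'w \<Rightarrow> real) \<Rightarrow> bool" where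
  "nonlinear_diffusion \<sigma> b \<Omega> \<beta> X \<longleftrightarrow>
     brownian_motion \<Omega> \<beta> \<and>
     (\<forall>t\<ge>0. X t \<in> borel_measurable \<Omega>) \<and>
     prob_space.indep_set \<Omega>
       (sets (vimage_algebra (space \<Omega>) (X 0) borel))
       (sets (vimage_algebra (space \<Omega>) (\<lambda>\<omega>. \<lambda>t\<in>{0..}. \<beta> t \<omega>) (Pi\<^sub>M {0..} (\<lambda>_. borel)))) \<and>
     (AE \<omega> in \<Omega>. continuous_on {0..} (\<lambda>t. X t \<omega>) \<and>
        (\<forall>t\<ge>0.
           set_integrable lborel {0..t} (\<lambda>s. b (cdf (distr \<Omega> borel (X s)) (X s \<omega>))) \<and>
           X t \<omega> = X 0 \<omega>
             + (LINT s:{0..t}|lborel. b (cdf (distr \<Omega> borel (X s)) (X s \<omega>)))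
             + \<sigma> * \<beta> t \<omega>))"

(* The type argument is the type of the sample space carrying the process; leaving it free
   in a hypothesis allows the process to live on an arbitrary probability space. *)
definition stationary_measure ::
    "'w itself \<Rightarrow> real \<Rightarrow> (real \<Rightarrow> real) \<Rightarrow> real measure \<Rightarrow> bool" where
  "stationary_measure _ \<sigma> b \<mu> \<longleftrightarrow>
     (\<exists>(\<Omega> :: 'w measure) \<beta> X. nonlinear_diffusion \<sigma> b \<Omega> \<beta> X \<and>
        (\<forall>t\<ge>0. distr \<Omega> borel (X t) = \<mu>))"

definition centered :: "real measure \<Rightarrow> bool" where
  "centered \<mu> \<longleftrightarrow> integrable \<mu> (\<lambda>x. x) \<and> (\<integral>x. x \<partial>\<mu>) = 0"

end

(* All laws of the process coincide, so only small times t need to be considered. Write c = 2/sigma^2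
   and F for the distribution function of the stationary measure nu. As X(0) is independent of the
   noise, a second order expansion of E phi(X(t)) = E phi(X(0)) around X(0) yields the weak form
   of the stationary Fokker-Planck equation without any stochastic calculus. Letting phi'' tend to
   indicators of intervals, and using that F pushes nu to the uniform distribution, this becomes
   the equation F' = c B(F) for a C^1 function F. Hence 0 < F < 1, and the density q = F' satisfies
   (ln q)' = c b(F).

   The free energy is minimal at nu because p ln p + c B >= p (ln (c B) + 1) pointwise, with equality
   for p = c B, and the integral of ln (c B(F_mu)) against mu does not depend on mu. The identity then
   is an integration by parts: the integral of ln q against mu - nu is minus the integral of
   c b(F) (F_mu - F). If mu has no first moment, its relative entropy with respect to nu is infinite,
   since q has exponential tails (b(0) > 0 > b(1)). *)

theory Submission
  imports Defs "HOL-Real_Asymp.Real_Asymp"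
begin

section \<open>The weak stationary equation\<close>

text \<open>The obstacle is regularity: at the outset \<open>cdf \<mu>inf\<close> may jump, so
  \<open>b (cdf \<mu>inf x)\<close> may be discontinuous and its values along a path need not
  converge as time tends to 0. The increment of \<open>X\<close> is therefore split into the drift
  integral \<open>A t\<close>, which depends on the noise, and the noise, which is independent of
  \<open>X 0\<close>. A test function is expanded backwards from \<open>X t\<close> in the former
  and forwards from \<open>X 0\<close> in the latter. In the time integral only
  \<open>\<psi>\<close>, which is Lipschitz, is moved from time \<open>t\<close> to time
  \<open>s\<close>, at a cost of order \<open>sqrt t\<close>; stationarity then evaluates the drift
  term exactly. All errors are of order \<open>t * sqrt t\<close>. A test function whose second
  derivative approximates the indicator of an interval grows linearly. On the entropy side the
  obstacle is infinite values. A first moment makes the energy and the integral of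
  \<open>ln q\<close> finite, so that the Boltzmann and the relative entropy of a density become
  infinite together.\<close>

lemma floor_grid_LIMSEQ: "(\<lambda>n. real (nat \<lfloor>real (Suc n) * max 0 t\<rfloor>) / real (Suc n)) \<longlonglongrightarrow> max 0 t"
proof (rule real_tendsto_sandwich)
  show "(\<lambda>n. max 0 t - 1 / real (Suc n)) \<longlonglongrightarrow> max 0 t"
    using tendsto_diff[OF tendsto_const[of "max 0 t"] LIMSEQ_inverse_real_of_nat] by (simp add: inverse_eq_divide)
  show "\<forall>\<^sub>F n in sequentially. max 0 t - 1 / real (Suc n)
      \<le> real (nat \<lfloor>real (Suc n) * max 0 t\<rfloor>) / real (Suc n)"
  proof (rule always_eventually, rule allI)
    fix n
    have "real (Suc n) * max 0 t - 1 \<le> of_int \<lfloor>real (Suc n) * max 0 t\<rfloor>" by linarith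
    then have "(real (Suc n) * max 0 t - 1) / real (Suc n)
        \<le> of_int \<lfloor>real (Suc n) * max 0 t\<rfloor> / real (Suc n)" by (rule divide_right_mono) simp
    then show "max 0 t - 1 / real (Suc n)
      \<le> real (nat \<lfloor>real (Suc n) * max 0 t\<rfloor>) / real (Suc n)"
      by (simp add: diff_divide_distrib)
  qed
  show "\<forall>\<^sub>F n in sequentially. real (nat \<lfloor>real (Suc n) * max 0 t\<rfloor>) / real (Suc n) \<le> max 0 t"
  proof (rule always_eventually, rule allI)
    fix n
    have "of_int \<lfloor>real (Suc n) * max 0 t\<rfloor> \<le> real (Suc n) * max 0 t" by linarith
    then have "of_int \<lfloor>real (Suc n) * max 0 t\<rfloor> / real (Suc n)
        \<le> (real (Suc n) * max 0 t) / real (Suc n)" by (rule divide_right_mono) simp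
    then show "real (nat \<lfloor>real (Suc n) * max 0 t\<rfloor>) / real (Suc n) \<le> max 0 t" by simp
  qed
qed (rule tendsto_const)

text \<open>The path is read at the grid point of mesh \<open>1 / Suc n\<close> just left of
  \<open>t\<close>. Each approximation involves only countably many random variables, and path
  continuity gives the limit. \<open>max 0 t\<close> extends the process to negative times, so that
  time can carry \<open>lborel\<close> in the Fubini argument below.\<close>

lemma measurable_continuous_process:
  fixes X :: "real \<Rightarrow> 'a \<Rightarrow> real"
  assumes meas: "\<And>t. t \<ge> 0 \<Longrightarrow> X t \<in> borel_measurable M"
    and cont: "\<And>\<omega>. \<omega> \<in> space M \<Longrightarrow> continuous_on {0..} (\<lambda>t. X t \<omega>)"
  shows "(\<lambda>(t, \<omega>). X (max 0 t) \<omega>) \<in> borel_measurable (borel \<Otimes>\<^sub>M M)"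
proof (rule borel_measurable_LIMSEQ_real)
  fix p :: "real \<times> 'a" assume p: "p \<in> space (borel \<Otimes>\<^sub>M M)"
  obtain t \<omega> where [simp]: "p = (t, \<omega>)" by (cases p)
  have \<omega>: "\<omega> \<in> space M" using p by (simp add: space_pair_measure)
  show "(\<lambda>n. case p of (t, \<omega>) \<Rightarrow> X (real (nat \<lfloor>real (Suc n) * max 0 t\<rfloor>) / real (Suc n)) \<omega>)
      \<longlonglongrightarrow> (case p of (t, \<omega>) \<Rightarrow> X (max 0 t) \<omega>)"
    using continuous_on_tendsto_compose[OF cont[OF \<omega>] floor_grid_LIMSEQ] by simp
next
  fix n
  show "(\<lambda>(t, \<omega>). X (real (nat \<lfloor>real (Suc n) * max 0 t\<rfloor>) / real (Suc n)) \<omega>)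
      \<in> borel_measurable (borel \<Otimes>\<^sub>M M)"
    unfolding split_beta
    by (rule measurable_compose_countable[where f="\<lambda>i p. X (real i / real (Suc n)) (snd p)"
          and g="\<lambda>p. nat \<lfloor>real (Suc n) * max 0 (fst p)\<rfloor>"])
       (auto intro!: measurable_compose[OF measurable_snd] meas)
qed

text \<open>The mean value inequality is applied twice, to the remainder of \<open>\<psi>\<close>
  and then to that of \<open>\<phi>\<close>. The constant is not sharp; what counts is the cubic
  order in \<open>z\<close>, because the third absolute moment of a Gaussian increment of variance
  \<open>t\<close> is of order \<open>t * sqrt t\<close>.\<close>

lemma second_order_taylor_bound:
  fixes \<phi> \<psi> h :: "real \<Rightarrow> real"
  assumes \<phi>: "\<And>x. (\<phi> has_real_derivative \<psi> x) (at x)"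
    and \<psi>: "\<And>x. (\<psi> has_real_derivative h x) (at x)"
    and lip: "\<And>x y. \<bar>h x - h y\<bar> \<le> C * \<bar>x - y\<bar>"
  shows "\<bar>\<phi> (x + z) - \<phi> x - \<psi> x * z - h x * z\<^sup>2 / 2\<bar> \<le> C * \<bar>z\<bar> ^ 3"
proof -
  have C: "C \<ge> 0" using lip[of 0 1] by auto
  define S where "S = cball (0::real) \<bar>z\<bar>"
  have S: "convex S" "0 \<in> S" "z \<in> S" "\<And>y. y \<in> S \<Longrightarrow> \<bar>y\<bar> \<le> \<bar>z\<bar>" by (auto simp: S_def)
  have 1: "\<bar>\<psi> (x + y) - \<psi> x - h x * y\<bar> \<le> C * \<bar>z\<bar>\<^sup>2" if y: "y \<in> S" for y
  proof -
    have "norm ((\<lambda>w. \<psi> (x + w) - \<psi> x - h x * w) y - (\<lambda>w. \<psi> (x + w) - \<psi> x - h x * w) 0)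
        \<le> (C * \<bar>z\<bar>) * norm (y - 0)"
    proof (rule field_differentiable_bound[OF S(1), where f'="\<lambda>w. h (x + w) - h x"])
      fix w assume "w \<in> S"
      then show "norm (h (x + w) - h x) \<le> C * \<bar>z\<bar>"
        using lip[of "x + w" x] S(4)[of w] C by (auto intro: order_trans mult_left_mono)
      show "((\<lambda>w. \<psi> (x + w) - \<psi> x - h x * w) has_field_derivative h (x + w) - h x) (at w within S)"
        by (auto intro!: derivative_eq_intros DERIV_chain2[where f=\<psi>, OF \<psi>])
    qed (use y S in auto)
    also have "\<dots> \<le> (C * \<bar>z\<bar>) * \<bar>z\<bar>" using S(4)[OF y] C by (intro mult_left_mono) auto
    finally show ?thesis by (simp add: power2_eq_square mult.assoc)
  qed
  have "norm ((\<lambda>w. \<phi> (x + w) - \<phi> x - \<psi> x * w - h x * w\<^sup>2 / 2) z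
      - (\<lambda>w. \<phi> (x + w) - \<phi> x - \<psi> x * w - h x * w\<^sup>2 / 2) 0) \<le> (C * \<bar>z\<bar>\<^sup>2) * norm (z - 0)"
  proof (rule field_differentiable_bound[OF S(1), where f'="\<lambda>w. \<psi> (x + w) - \<psi> x - h x * w"])
    fix w assume "w \<in> S"
    then show "norm (\<psi> (x + w) - \<psi> x - h x * w) \<le> C * \<bar>z\<bar>\<^sup>2" using 1 by simp
    show "((\<lambda>w. \<phi> (x + w) - \<phi> x - \<psi> x * w - h x * w\<^sup>2 / 2) has_field_derivative
        \<psi> (x + w) - \<psi> x - h x * w) (at w within S)"
      by (auto intro!: derivative_eq_intros DERIV_chain2[where f=\<phi>, OF \<phi>])
  qed (use S in auto)
  then show ?thesis by (simp add: power2_eq_square power3_eq_cube mult.assoc)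
qed

lemma first_order_taylor_bound:
  fixes \<phi> \<psi> h :: "real \<Rightarrow> real"
  assumes \<phi>: "\<And>x. (\<phi> has_real_derivative \<psi> x) (at x)"
    and \<psi>: "\<And>x. (\<psi> has_real_derivative h x) (at x)"
    and h: "\<And>x. \<bar>h x\<bar> \<le> C"
  shows "\<bar>\<phi> (x + z) - \<phi> x - \<psi> x * z\<bar> \<le> C * z\<^sup>2"
proof -
  have C: "C \<ge> 0" using h[of 0] by auto
  define S where "S = cball (0::real) \<bar>z\<bar>"
  have S: "convex S" "0 \<in> S" "z \<in> S" "\<And>y. y \<in> S \<Longrightarrow> \<bar>y\<bar> \<le> \<bar>z\<bar>" by (auto simp: S_def)
  have "norm ((\<lambda>w. \<phi> (x + w) - \<phi> x - \<psi> x * w) z - (\<lambda>w. \<phi> (x + w) - \<phi> x - \<psi> x * w) 0)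
      \<le> (C * \<bar>z\<bar>) * norm (z - 0)"
  proof (rule field_differentiable_bound[OF S(1), where f'="\<lambda>w. \<psi> (x + w) - \<psi> x"])
    fix w assume w: "w \<in> S"
    have "norm (\<psi> (x + w) - \<psi> x) \<le> C * norm ((x + w) - x)"
      by (rule field_differentiable_bound[where S=UNIV and f'=h]) (use h \<psi> in auto)
    also have "\<dots> \<le> C * \<bar>z\<bar>" using S(4)[OF w] C by (auto intro: mult_left_mono)
    finally show "norm (\<psi> (x + w) - \<psi> x) \<le> C * \<bar>z\<bar>" .
    show "((\<lambda>w. \<phi> (x + w) - \<phi> x - \<psi> x * w) has_field_derivative \<psi> (x + w) - \<psi> x) (at w within S)"
      by (auto intro!: derivative_eq_intros DERIV_chain2[where f=\<phi>, OF \<phi>])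
  qed (use S in auto)
  then show ?thesis by (simp add: power2_eq_square mult.assoc)
qed

lemma (in prob_space) centered_normal_moments:
  assumes D: "distributed M lborel W (normal_density 0 (sqrt d))" and d: "d > 0"
  shows "integrable M W" "expectation W = 0"
    "integrable M (\<lambda>\<omega>. (W \<omega>)\<^sup>2)" "expectation (\<lambda>\<omega>. (W \<omega>)\<^sup>2) = d"
    "integrable M (\<lambda>\<omega>. \<bar>W \<omega>\<bar>)" "expectation (\<lambda>\<omega>. \<bar>W \<omega>\<bar>) \<le> sqrt d"
    "integrable M (\<lambda>\<omega>. \<bar>W \<omega>\<bar> ^ 3)" "expectation (\<lambda>\<omega>. \<bar>W \<omega>\<bar> ^ 3) \<le> 2 * (d * sqrt d)"
proof -
  have s: "0 < sqrt d" using d by simp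
  have int: "integrable lborel (\<lambda>x. normal_density 0 (sqrt d) x * f x) \<longleftrightarrow> integrable M (\<lambda>\<omega>. f (W \<omega>))"
    "(\<integral>x. normal_density 0 (sqrt d) x * f x \<partial>lborel) = expectation (\<lambda>\<omega>. f (W \<omega>))"
    if "f \<in> borel_measurable borel" for f :: "real \<Rightarrow> real"
    using that by (intro distributed_integrable[OF D] distributed_integral[OF D]; simp)+
  \<comment> \<open>The odd absolute moments carry the factor \<open>sqrt (2 / pi)\<close>, which
    this bound discards.\<close>
  have c1: "sqrt (2 / pi) \<le> 1" using pi_gt3 by (simp add: real_sqrt_le_1_iff)
  show "integrable M W" "expectation W = 0"
    using normal_moment_odd[OF s, of 0 0] int[of "\<lambda>x. x"]
    by (auto simp: has_bochner_integral_iff)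
  show "integrable M (\<lambda>\<omega>. (W \<omega>)\<^sup>2)" "expectation (\<lambda>\<omega>. (W \<omega>)\<^sup>2) = d"
    using normal_moment_even[OF s, of 0 1] int[of "\<lambda>x. x\<^sup>2"] d
    by (auto simp: has_bochner_integral_iff)
  show "integrable M (\<lambda>\<omega>. \<bar>W \<omega>\<bar>)" "expectation (\<lambda>\<omega>. \<bar>W \<omega>\<bar>) \<le> sqrt d"
    using normal_moment_abs_odd[OF s, of 0 0] int[of "\<lambda>x. \<bar>x\<bar>"] d c1
      mult_left_mono[OF c1, of "sqrt d"]
    by (auto simp: has_bochner_integral_iff)
  show "integrable M (\<lambda>\<omega>. \<bar>W \<omega>\<bar> ^ 3)" "expectation (\<lambda>\<omega>. \<bar>W \<omega>\<bar> ^ 3) \<le> 2 * (d * sqrt d)"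
    using normal_moment_abs_odd[OF s, of 0 1] int[of "\<lambda>x. \<bar>x\<bar> ^ 3"] d c1
      mult_left_mono[OF c1, of "2 * (d * sqrt d)"]
    by (auto simp: has_bochner_integral_iff power3_eq_cube eval_nat_numeral mult_ac)
qed

text \<open>The hypothesis concerns the sigma-algebra of the whole path in the product space. That
  of a single coordinate is contained in it, since evaluation at \<open>i\<close> is
  measurable.\<close>

lemma (in prob_space) indep_var_vimage_algebra_component:
  fixes Y :: "'a \<Rightarrow> real" and Z :: "'i \<Rightarrow> 'a \<Rightarrow> real"
  assumes ind: "indep_set (sets (vimage_algebra (space M) Y borel))
      (sets (vimage_algebra (space M) (\<lambda>\<omega>. \<lambda>i\<in>I. Z i \<omega>) (Pi\<^sub>M I (\<lambda>_. borel))))"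
    and i: "i \<in> I" and Y: "random_variable borel Y" and Z: "random_variable borel (Z i)"
  shows "indep_var borel Y borel (Z i)"
  unfolding indep_var_eq
proof (intro conjI Y Z)
  let ?V = "vimage_algebra (space M) (\<lambda>\<omega>. \<lambda>i\<in>I. Z i \<omega>) (Pi\<^sub>M I (\<lambda>_. borel))"
  have "(\<lambda>\<omega>. \<lambda>i\<in>I. Z i \<omega>) \<in> ?V \<rightarrow>\<^sub>M Pi\<^sub>M I (\<lambda>_. borel)"
    by (rule measurable_vimage_algebra1) (auto simp: space_PiM)
  from measurable_compose[OF this measurable_component_singleton[OF i]]
  have "Z i \<in> borel_measurable ?V" using i by simp
  then have "{Z i -` A \<inter> space M | A. A \<in> sets borel} \<subseteq> sets ?V"
    by (auto dest: measurable_sets)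
  then have "sigma_sets (space M) {Z i -` A \<inter> space M | A. A \<in> sets borel} \<subseteq> sets ?V"
    using sets.sigma_sets_subset[of _ ?V] by simp
  moreover have "sigma_sets (space M) {Y -` A \<inter> space M | A. A \<in> sets borel}
      = sets (vimage_algebra (space M) Y borel)"
    by (simp add: sets_vimage_algebra)
  ultimately show "indep_set (sigma_sets (space M) {Y -` A \<inter> space M | A. A \<in> sets borel})
      (sigma_sets (space M) {Z i -` A \<inter> space M | A. A \<in> sets borel})"
    using ind unfolding indep_sets2_eq by blast
qed

text \<open>Division by \<open>t\<close> and the limit \<open>t\<close> to 0 from the right: an
  error of order \<open>t * sqrt t\<close> cannot hide a nonzero first order coefficient.\<close>

lemma eq_zero_if_le_mult_sqrt:
  fixes a M :: real
  assumes "\<And>t. 0 < t \<Longrightarrow> t \<le> 1 \<Longrightarrow> \<bar>a\<bar> * t \<le> M * (t * sqrt t)"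
  shows "a = 0"
proof -
  have "\<bar>a\<bar> \<le> 0"
  proof (rule tendsto_lowerbound)
    show "((\<lambda>t. M * sqrt t) \<longlongrightarrow> 0) (at_right 0)"
      by (auto intro!: tendsto_eq_intros)
    show "\<forall>\<^sub>F t in at_right 0. \<bar>a\<bar> \<le> M * sqrt t"
      using eventually_at_right_real[of 0 1, simplified]
    proof eventually_elim
      case (elim t)
      then show ?case using assms[of t] by (simp add: mult.commute mult.left_commute)
    qed
  qed simp
  then show ?thesis by simp
qed

text \<open>As \<open>X t - A t = X 0 + \<sigma> * W\<close>, the differences
  \<open>\<phi> (X t) - \<phi> (X t - A t)\<close> and
  \<open>\<phi> (X 0 + \<sigma> * W) - \<phi> (X 0)\<close> add up to
  \<open>\<phi> (X t) - \<phi> (X 0)\<close>, which has mean 0 by stationarity. Their means are, to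
  first order in \<open>t\<close>, the drift and the diffusion term of the conclusion.\<close>

lemma stationary_weak_equation:
  fixes \<Omega> :: "'w measure" and \<phi> \<psi> h :: "real \<Rightarrow> real"
  assumes nd: "nonlinear_diffusion \<sigma> b \<Omega> \<beta> X"
    and st: "\<And>t. t \<ge> 0 \<Longrightarrow> distr \<Omega> borel (X t) = \<mu>"
    and int: "integrable \<mu> (\<lambda>x. x)"
    and gm: "(\<lambda>x. b (cdf \<mu> x)) \<in> borel_measurable borel"
    and gb: "\<And>x. \<bar>b (cdf \<mu> x)\<bar> \<le> K"
    and \<phi>: "\<And>x. (\<phi> has_real_derivative \<psi> x) (at x)"
    and \<psi>: "\<And>x. (\<psi> has_real_derivative h x) (at x)"
    and \<psi>C: "\<And>x. \<bar>\<psi> x\<bar> \<le> C" and hC: "\<And>x. \<bar>h x\<bar> \<le> C"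
    and lip: "\<And>x y. \<bar>h x - h y\<bar> \<le> C * \<bar>x - y\<bar>"
  shows "\<sigma>\<^sup>2 / 2 * (\<integral>x. h x \<partial>\<mu>) + (\<integral>x. \<psi> x * b (cdf \<mu> x) \<partial>\<mu>) = 0"
proof -
  define g where "g = (\<lambda>x. b (cdf \<mu> x))"
  have bm: "brownian_motion \<Omega> \<beta>"
    and X[measurable]: "\<And>t. t \<ge> 0 \<Longrightarrow> X t \<in> borel_measurable \<Omega>"
    and ind: "prob_space.indep_set \<Omega>
       (sets (vimage_algebra (space \<Omega>) (X 0) borel))
       (sets (vimage_algebra (space \<Omega>) (\<lambda>\<omega>. \<lambda>t\<in>{0..}. \<beta> t \<omega>) (Pi\<^sub>M {0..} (\<lambda>_. borel))))"
    and sde: "AE \<omega> in \<Omega>. continuous_on {0..} (\<lambda>t. X t \<omega>) \<and>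
        (\<forall>t\<ge>0.
           set_integrable lborel {0..t} (\<lambda>s. b (cdf (distr \<Omega> borel (X s)) (X s \<omega>))) \<and>
           X t \<omega> = X 0 \<omega>
             + (LINT s:{0..t}|lborel. b (cdf (distr \<Omega> borel (X s)) (X s \<omega>)))
             + \<sigma> * \<beta> t \<omega>)"
    using nd unfolding nonlinear_diffusion_def by auto
  have ps: "prob_space \<Omega>"
    and \<beta>[measurable]: "\<And>t. t \<ge> 0 \<Longrightarrow> \<beta> t \<in> borel_measurable \<Omega>"
    and \<beta>0: "AE \<omega> in \<Omega>. \<beta> 0 \<omega> = 0"
    and incr: "\<And>s t. 0 \<le> s \<Longrightarrow> s < t \<Longrightarrow>
        distributed \<Omega> lborel (\<lambda>\<omega>. \<beta> t \<omega> - \<beta> s \<omega>) (normal_density 0 (sqrt (t - s)))"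
    using bm unfolding brownian_motion_def by auto
  interpret prob_space \<Omega> by (rule ps)
  interpret P: pair_sigma_finite lborel \<Omega> ..
  have [measurable]: "g \<in> borel_measurable borel" using gm by (simp add: g_def)
  have g: "\<bar>g x\<bar> \<le> K" for x using gb by (simp add: g_def)
  have K: "0 \<le> K" and C: "0 \<le> C" using g[of 0] hC[of 0] by auto
  have "continuous_on UNIV \<phi>" "continuous_on UNIV \<psi>"
    using \<phi> \<psi> by (auto intro!: continuous_at_imp_continuous_on DERIV_isCont)
  then have [measurable]: "\<phi> \<in> borel_measurable borel" "\<psi> \<in> borel_measurable borel"
    by (auto intro: borel_measurable_continuous_onI)
  have "C-lipschitz_on UNIV h" using lip C by (auto simp: lipschitz_on_def dist_real_def)
  then have [measurable]: "h \<in> borel_measurable borel"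
    by (auto intro!: borel_measurable_continuous_onI lipschitz_on_continuous_on)
  have [simp]: "sets \<mu> = sets borel" "space \<mu> = UNIV" using st[of 0, symmetric] by auto
  have E: "expectation (\<lambda>\<omega>. f (X t \<omega>)) = (\<integral>x. f x \<partial>\<mu>)"
    if "t \<ge> 0" "f \<in> borel_measurable borel" for t and f :: "real \<Rightarrow> real"
    using integral_distr[OF X[OF that(1)] that(2)] unfolding st[OF that(1)] by (rule sym)
  have XI: "integrable \<Omega> (X t)" if "t \<ge> 0" for t
    using integrable_distr[OF X[OF that], of "\<lambda>x. x"] int unfolding st[OF that] by blast
  have \<phi>lip: "\<bar>\<phi> x - \<phi> y\<bar> \<le> C * \<bar>x - y\<bar>" for x y
  proof -
    have "norm (\<phi> x - \<phi> y) \<le> C * norm (x - y)"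
      by (rule field_differentiable_bound[where S=UNIV and f'=\<psi>]) (use \<phi> \<psi>C in auto)
    then show ?thesis by simp
  qed
  have \<psi>lip: "\<bar>\<psi> x - \<psi> y\<bar> \<le> C * \<bar>x - y\<bar>" for x y
  proof -
    have "norm (\<psi> x - \<psi> y) \<le> C * norm (x - y)"
      by (rule field_differentiable_bound[where S=UNIV and f'=h]) (use \<psi> hC in auto)
    then show ?thesis by simp
  qed
  have \<phi>I: "integrable \<Omega> (\<lambda>\<omega>. \<phi> (X t \<omega>))" if "t \<ge> 0" for t
  proof (rule Bochner_Integration.integrable_bound)
    show "integrable \<Omega> (\<lambda>\<omega>. \<bar>\<phi> 0\<bar> + C * \<bar>X t \<omega>\<bar>)" using XI[OF that] by auto
    show "AE \<omega> in \<Omega>. norm (\<phi> (X t \<omega>)) \<le> norm (\<bar>\<phi> 0\<bar> + C * \<bar>X t \<omega>\<bar>)"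
    proof (rule AE_I2)
      fix \<omega> show "norm (\<phi> (X t \<omega>)) \<le> norm (\<bar>\<phi> 0\<bar> + C * \<bar>X t \<omega>\<bar>)"
        using \<phi>lip[of "X t \<omega>" 0] C by simp
    qed
  qed (use that in measurable)

  define ok where "ok \<omega> \<longleftrightarrow> continuous_on {0..} (\<lambda>t. X t \<omega>) \<and>
      (\<forall>t\<ge>0. X t \<omega> = X 0 \<omega> + (LINT s:{0..t}|lborel. g (X s \<omega>)) + \<sigma> * \<beta> t \<omega>)" for \<omega>
  have "AE \<omega> in \<Omega>. ok \<omega>"
    using sde
  proof eventually_elim
    case (elim \<omega>)
    have eq: "(LINT s:{0..t}|lborel. b (cdf (distr \<Omega> borel (X s)) (X s \<omega>)))
        = (LINT s:{0..t}|lborel. g (X s \<omega>))" for t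
      by (rule set_lebesgue_integral_cong) (auto simp: st g_def)
    show ?case using elim unfolding eq ok_def by blast
  qed
  then obtain N where "\<forall>\<omega>\<in>space \<Omega> - N. ok \<omega>" and N: "N \<in> null_sets \<Omega>"
    unfolding eventually_ae_filter by auto
  then have good: "\<And>\<omega>. \<omega> \<in> space \<Omega> - N \<Longrightarrow> ok \<omega>" by blast
  \<comment> \<open>Path continuity and the equation hold only almost everywhere. Setting the
    process to 0 on the null set \<open>N\<close> makes every path continuous, as joint
    measurability requires.\<close>
  define X' where "X' t \<omega> = (if \<omega> \<in> N then 0 else X t \<omega>)" for t \<omega>
  have [measurable]: "N \<in> sets \<Omega>" using N by auto
  have X'm: "X' t \<in> borel_measurable \<Omega>" if "t \<ge> 0" for t
    unfolding X'_def using that by measurable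
  have X'X: "AE \<omega> in \<Omega>. \<forall>t. X' t \<omega> = X t \<omega>"
    using AE_not_in[OF N] by eventually_elim (simp add: X'_def)
  have "(\<lambda>(t, \<omega>). X' (max 0 t) \<omega>) \<in> borel_measurable (borel \<Otimes>\<^sub>M \<Omega>)"
  proof (rule measurable_continuous_process)
    fix \<omega> assume "\<omega> \<in> space \<Omega>"
    then show "continuous_on {0..} (\<lambda>t. X' t \<omega>)"
      using good[of \<omega>] unfolding ok_def by (cases "\<omega> \<in> N") (simp add: X'_def, auto simp only: X'_def if_False)
  qed (rule X'm)
  then have Zm[measurable]: "(\<lambda>p. X' (max 0 (fst p)) (snd p)) \<in> borel_measurable (lborel \<Otimes>\<^sub>M \<Omega>)"
    by (simp add: split_beta' cong: measurable_cong_sets)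
  define A where "A t \<omega> = (\<integral>s. indicator {0..t} s * g (X' (max 0 s) \<omega>) \<partial>lborel)" for t \<omega>
  have Am[measurable]: "A t \<in> borel_measurable \<Omega>" for t
  proof -
    have "(\<lambda>p. X' (max 0 (snd p)) (fst p)) \<in> borel_measurable (\<Omega> \<Otimes>\<^sub>M lborel)"
      using measurable_compose[OF measurable_pair_swap' Zm] by (simp add: split_beta')
    note this[measurable]
    show ?thesis unfolding A_def by measurable
  qed
  have indI: "integrable lborel (indicator {0..t} :: real \<Rightarrow> real)" for t :: real
    by (rule integrable_real_indicator) (auto simp: emeasure_lborel_Icc_eq)
  have Ab: "\<bar>A t \<omega>\<bar> \<le> K * t" if "t \<ge> 0" for t \<omega>
  proof -
    have "\<bar>A t \<omega>\<bar> \<le> (\<integral>s. indicator {0..t} s * K \<partial>lborel)"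
      unfolding A_def
    proof (rule order_trans[OF integral_abs_bound integral_mono'])
      show "integrable lborel (\<lambda>s. indicator {0..t} s * K)" using indI by simp
      show "\<bar>indicator {0..t} s * g (X' (max 0 s) \<omega>)\<bar> \<le> indicator {0..t} s * K" for s
        using g by (simp split: split_indicator)
      show "0 \<le> indicator {0..t} s * K" for s using K by simp
    qed
    then show ?thesis using that by (simp add: mult.commute)
  qed
  have sde': "AE \<omega> in \<Omega>. \<forall>t\<ge>0. X t \<omega> = X 0 \<omega> + A t \<omega> + \<sigma> * \<beta> t \<omega>"
    using AE_not_in[OF N] AE_space
  proof eventually_elim
    case (elim \<omega>)
    have eq: "(LINT s:{0..t}|lborel. g (X s \<omega>)) = A t \<omega>" for t
      unfolding A_def set_lebesgue_integral_def using elim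
      by (intro Bochner_Integration.integral_cong) (auto simp: X'_def split: split_indicator)
    show ?case using good[of \<omega>] elim unfolding ok_def eq by blast
  qed

  \<comment> \<open>The bounded drift contributes order \<open>t\<close> and the noise order
    \<open>sqrt t\<close>, uniformly in \<open>s\<close>. The factor 2 comes from estimating
    \<open>A t\<close> and \<open>A s\<close> separately.\<close>
  have dX: "integrable \<Omega> (\<lambda>\<omega>. \<bar>X t \<omega> - X s \<omega>\<bar>)"
    "expectation (\<lambda>\<omega>. \<bar>X t \<omega> - X s \<omega>\<bar>) \<le> 2 * K * t + \<bar>\<sigma>\<bar> * sqrt t"
    if st: "0 \<le> s" "s \<le> t" for s t
  proof -
    show I: "integrable \<Omega> (\<lambda>\<omega>. \<bar>X t \<omega> - X s \<omega>\<bar>)" using XI[of t] XI[of s] st by simp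
    show "expectation (\<lambda>\<omega>. \<bar>X t \<omega> - X s \<omega>\<bar>) \<le> 2 * K * t + \<bar>\<sigma>\<bar> * sqrt t"
    proof (cases "s = t")
      case True then show ?thesis using st K by simp
    next
      case False
      then have "s < t" using st by simp
      note W = centered_normal_moments[OF incr[OF st(1) this]]
      have "expectation (\<lambda>\<omega>. \<bar>X t \<omega> - X s \<omega>\<bar>) \<le> expectation (\<lambda>\<omega>. 2 * K * t + \<bar>\<sigma>\<bar> * \<bar>\<beta> t \<omega> - \<beta> s \<omega>\<bar>)"
      proof (rule integral_mono_AE[OF I])
        show "integrable \<Omega> (\<lambda>\<omega>. 2 * K * t + \<bar>\<sigma>\<bar> * \<bar>\<beta> t \<omega> - \<beta> s \<omega>\<bar>)" using W \<open>s < t\<close> by simp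
        show "AE \<omega> in \<Omega>. \<bar>X t \<omega> - X s \<omega>\<bar> \<le> 2 * K * t + \<bar>\<sigma>\<bar> * \<bar>\<beta> t \<omega> - \<beta> s \<omega>\<bar>"
          using sde'
        proof eventually_elim
          case (elim \<omega>)
          have "X t \<omega> - X s \<omega> = A t \<omega> - A s \<omega> + \<sigma> * (\<beta> t \<omega> - \<beta> s \<omega>)"
            using elim[rule_format, of t] elim[rule_format, of s] st
            by (simp only: right_diff_distrib)
          then have "\<bar>X t \<omega> - X s \<omega>\<bar> \<le> \<bar>A t \<omega>\<bar> + \<bar>A s \<omega>\<bar> + \<bar>\<sigma>\<bar> * \<bar>\<beta> t \<omega> - \<beta> s \<omega>\<bar>"
            by (simp add: abs_mult[symmetric])
          moreover have "\<bar>A t \<omega>\<bar> \<le> K * t" "\<bar>A s \<omega>\<bar> \<le> K * t"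
            using Ab[of t \<omega>] Ab[of s \<omega>] st mult_left_mono[OF st(2) K] by auto
          ultimately show ?case by simp
        qed
      qed
      also have "\<dots> = 2 * K * t + \<bar>\<sigma>\<bar> * expectation (\<lambda>\<omega>. \<bar>\<beta> t \<omega> - \<beta> s \<omega>\<bar>)"
        using W \<open>s < t\<close> by (simp add: prob_space)
      also have "\<dots> \<le> 2 * K * t + \<bar>\<sigma>\<bar> * sqrt t"
      proof -
        have "expectation (\<lambda>\<omega>. \<bar>\<beta> t \<omega> - \<beta> s \<omega>\<bar>) \<le> sqrt (t - s)" using W \<open>s < t\<close> by simp
        also have "\<dots> \<le> sqrt t" using st by simp
        finally show ?thesis by (intro add_left_mono mult_left_mono) auto
      qed
      finally show ?thesis .
    qed
  qed

  define I where "I = (\<integral>x. \<psi> x * g x \<partial>\<mu>)"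
  \<comment> \<open>By Fubini, \<open>\<psi>\<close> at time \<open>t\<close> meets the drift at
    time \<open>s\<close>. Replacing \<open>\<psi> (X t)\<close> by \<open>\<psi> (X s)\<close>
    costs \<open>C * K\<close> times the mean displacement and asks nothing of \<open>g\<close>
    beyond boundedness; the mean of \<open>\<psi> (X s) * g (X s)\<close> is then \<open>I\<close>
    for every \<open>s\<close>.\<close>
  have drift: "\<bar>expectation (\<lambda>\<omega>. \<psi> (X t \<omega>) * A t \<omega>) - t * I\<bar> \<le> t * (C * K * (2 * K * t + \<bar>\<sigma>\<bar> * sqrt t))"
    if t: "0 < t" for t
  proof -
    have [measurable]: "X t \<in> borel_measurable \<Omega>" using t by simp
    define f where "f s \<omega> = indicator {0..t} s * (\<psi> (X t \<omega>) * g (X' (max 0 s) \<omega>))" for s \<omega>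
    have bnd: "\<bar>\<psi> x * g y\<bar> \<le> C * K" for x y
      unfolding abs_mult using g \<psi>C C by (intro mult_mono) auto
    have fI: "integrable (lborel \<Otimes>\<^sub>M \<Omega>) (case_prod f)"
    proof (rule integrableI_bounded_set[where A="{0..t} \<times> space \<Omega>" and B="C * K"])
      show "case_prod f \<in> borel_measurable (lborel \<Otimes>\<^sub>M \<Omega>)"
        unfolding f_def split_beta' by measurable
      show "emeasure (lborel \<Otimes>\<^sub>M \<Omega>) ({0..t} \<times> space \<Omega>) < \<infinity>"
        using t by (simp add: emeasure_pair_measure_Times emeasure_space_1)
      show "AE x in lborel \<Otimes>\<^sub>M \<Omega>. x \<in> {0..t} \<times> space \<Omega> \<longrightarrow> norm (case_prod f x) \<le> C * K"
        by (rule AE_I2) (auto simp: f_def bnd)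
      show "AE x in lborel \<Otimes>\<^sub>M \<Omega>. x \<notin> {0..t} \<times> space \<Omega> \<longrightarrow> case_prod f x = 0"
        by (rule AE_I2) (auto simp: f_def space_pair_measure split: split_indicator_asm)
    qed auto
    have "expectation (\<lambda>\<omega>. \<psi> (X t \<omega>) * A t \<omega>) = expectation (\<lambda>\<omega>. \<integral>s. f s \<omega> \<partial>lborel)"
    proof (intro Bochner_Integration.integral_cong refl)
      fix \<omega>
      have "\<psi> (X t \<omega>) * A t \<omega> = (\<integral>s. \<psi> (X t \<omega>) * (indicator {0..t} s * g (X' (max 0 s) \<omega>)) \<partial>lborel)"
        unfolding A_def by (rule integral_mult_right_zero[symmetric])
      also have "\<dots> = (\<integral>s. f s \<omega> \<partial>lborel)"
        unfolding f_def by (simp add: mult.left_commute)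
      finally show "\<psi> (X t \<omega>) * A t \<omega> = (\<integral>s. f s \<omega> \<partial>lborel)" .
    qed
    also have "\<dots> = (\<integral>s. expectation (f s) \<partial>lborel)"
      by (rule P.Fubini_integral[OF fI])
    finally have 1: "expectation (\<lambda>\<omega>. \<psi> (X t \<omega>) * A t \<omega>) = (\<integral>s. expectation (f s) \<partial>lborel)" .
    have 2: "integrable lborel (\<lambda>s. expectation (f s))"
      using P.integrable_fst'[OF fI] by simp
    have 3: "\<bar>expectation (f s) - indicator {0..t} s * I\<bar>
        \<le> indicator {0..t} s * (C * K * (2 * K * t + \<bar>\<sigma>\<bar> * sqrt t))" for s
    proof (cases "s \<in> {0..t}")
      case True
      then have s: "0 \<le> s" "s \<le> t" by auto
      have [measurable]: "X s \<in> borel_measurable \<Omega>" using s by simp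
      have bi: "integrable \<Omega> (\<lambda>\<omega>. \<psi> (X u \<omega>) * g (X s \<omega>))" if "u \<ge> 0" for u
        using that bnd by (intro integrable_const_bound[where B="C * K"]) auto
      have [measurable]: "X' s \<in> borel_measurable \<Omega>" using s(1) by (rule X'm)
      have fs: "f s = (\<lambda>\<omega>. \<psi> (X t \<omega>) * g (X' s \<omega>))" using s by (auto simp: f_def)
      have "expectation (f s) = expectation (\<lambda>\<omega>. \<psi> (X t \<omega>) * g (X s \<omega>))"
        unfolding fs using X'X by (intro integral_cong_AE) (auto elim!: eventually_mono)
      moreover have "I = expectation (\<lambda>\<omega>. \<psi> (X s \<omega>) * g (X s \<omega>))"
        unfolding I_def using E[OF s(1), of "\<lambda>x. \<psi> x * g x"] by simp
      ultimately have "\<bar>expectation (f s) - I\<bar>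
          = \<bar>expectation (\<lambda>\<omega>. \<psi> (X t \<omega>) * g (X s \<omega>) - \<psi> (X s \<omega>) * g (X s \<omega>))\<bar>"
        using bi[of t] bi[of s] s by simp
      also have "\<dots> \<le> expectation (\<lambda>\<omega>. C * K * \<bar>X t \<omega> - X s \<omega>\<bar>)"
      proof (rule order_trans[OF integral_abs_bound integral_mono])
        fix \<omega>
        have "\<bar>\<psi> (X t \<omega>) * g (X s \<omega>) - \<psi> (X s \<omega>) * g (X s \<omega>)\<bar>
            = \<bar>\<psi> (X t \<omega>) - \<psi> (X s \<omega>)\<bar> * \<bar>g (X s \<omega>)\<bar>"
          by (simp add: abs_mult[symmetric] left_diff_distrib)
        also have "\<dots> \<le> (C * \<bar>X t \<omega> - X s \<omega>\<bar>) * K"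
          using \<psi>lip g C by (intro mult_mono) auto
        finally show "\<bar>\<psi> (X t \<omega>) * g (X s \<omega>) - \<psi> (X s \<omega>) * g (X s \<omega>)\<bar> \<le> C * K * \<bar>X t \<omega> - X s \<omega>\<bar>"
          by (simp add: mult_ac)
      qed (use bi[of t] bi[of s] dX[OF s] s in auto)
      also have "\<dots> \<le> C * K * (2 * K * t + \<bar>\<sigma>\<bar> * sqrt t)"
        using dX[OF s] C K by (auto intro!: mult_left_mono)
      finally show ?thesis using True by simp
    next
      case False
      then have "f s = (\<lambda>_. 0)" by (auto simp: f_def)
      with False show ?thesis by simp
    qed
    have "expectation (\<lambda>\<omega>. \<psi> (X t \<omega>) * A t \<omega>) - t * I
        = (\<integral>s. expectation (f s) - indicator {0..t} s * I \<partial>lborel)"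
      using 1 2 t indI by simp
    also have "\<bar>\<dots>\<bar> \<le> (\<integral>s. indicator {0..t} s * (C * K * (2 * K * t + \<bar>\<sigma>\<bar> * sqrt t)) \<partial>lborel)"
      by (rule order_trans[OF integral_abs_bound integral_mono]) (use 2 3 indI in auto)
    also have "\<dots> = t * (C * K * (2 * K * t + \<bar>\<sigma>\<bar> * sqrt t))" using t by simp
    finally show ?thesis .
  qed

  define H where "H = (\<integral>x. h x \<partial>\<mu>)"
  have diffusion: "\<bar>\<sigma>\<^sup>2 / 2 * t * H + expectation (\<lambda>\<omega>. \<psi> (X t \<omega>) * A t \<omega>)\<bar>
      \<le> C * (K * t)\<^sup>2 + C * \<bar>\<sigma>\<bar> ^ 3 * (2 * (t * sqrt t))" if t: "0 < t" for t
  proof -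
    have [measurable]: "X t \<in> borel_measurable \<Omega>" "\<beta> t \<in> borel_measurable \<Omega>"
      "X 0 \<in> borel_measurable \<Omega>" using t by simp_all
    \<comment> \<open>The Gaussian moments are known for increments, independence for the values
      \<open>\<beta> t\<close>. Both refer to the same variable almost everywhere because
      \<open>\<beta> 0\<close> vanishes there.\<close>
    define W where "W = (\<lambda>\<omega>. \<beta> t \<omega> - \<beta> 0 \<omega>)"
    have [measurable]: "W \<in> borel_measurable \<Omega>" unfolding W_def by simp
    have Wm: "integrable \<Omega> W" "expectation W = 0"
      "integrable \<Omega> (\<lambda>\<omega>. (W \<omega>)\<^sup>2)" "expectation (\<lambda>\<omega>. (W \<omega>)\<^sup>2) = t"
      "integrable \<Omega> (\<lambda>\<omega>. \<bar>W \<omega>\<bar> ^ 3)" "expectation (\<lambda>\<omega>. \<bar>W \<omega>\<bar> ^ 3) \<le> 2 * (t * sqrt t)"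
      unfolding W_def using centered_normal_moments[OF incr[of 0 t]] t by auto
    have \<beta>W: "AE \<omega> in \<Omega>. \<beta> t \<omega> = W \<omega>" using \<beta>0 by eventually_elim (simp add: W_def)
    have iv: "indep_var borel (X 0) borel (\<beta> t)"
      using ind t by (intro indep_var_vimage_algebra_component[where I="{0..}"]) auto
    have iv1: "integrable \<Omega> (\<lambda>\<omega>. \<psi> (X 0 \<omega>) * W \<omega>)" "expectation (\<lambda>\<omega>. \<psi> (X 0 \<omega>) * W \<omega>) = 0"
      and iv2: "integrable \<Omega> (\<lambda>\<omega>. h (X 0 \<omega>) * (W \<omega>)\<^sup>2)" "expectation (\<lambda>\<omega>. h (X 0 \<omega>) * (W \<omega>)\<^sup>2) = H * t"
    proof -
      have b1: "integrable \<Omega> (\<lambda>\<omega>. \<psi> (X 0 \<omega>))" "integrable \<Omega> (\<lambda>\<omega>. h (X 0 \<omega>))"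
        using \<psi>C hC by (auto intro!: integrable_const_bound[where B=C])
      have c1: "integrable \<Omega> (\<beta> t)" "integrable \<Omega> (\<lambda>\<omega>. (\<beta> t \<omega>)\<^sup>2)"
        "expectation (\<beta> t) = 0" "expectation (\<lambda>\<omega>. (\<beta> t \<omega>)\<^sup>2) = t"
        subgoal using Wm(1) by (rule integrable_cong_AE_imp) (use \<beta>W in auto)
        subgoal using Wm(3) by (rule integrable_cong_AE_imp) (use \<beta>W in auto)
        subgoal using Wm(2) integral_cong_AE[of "\<beta> t" \<Omega> W] \<beta>W by auto
        subgoal by (rule trans[OF integral_cong_AE Wm(4)]) (use \<beta>W in \<open>auto elim!: eventually_mono\<close>)
        done
      have i1: "indep_var borel (\<lambda>\<omega>. \<psi> (X 0 \<omega>)) borel (\<beta> t)"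
        by (rule indep_var_compose[OF iv, of \<psi> borel "\<lambda>x. x" borel, unfolded comp_def]) auto
      have i2: "indep_var borel (\<lambda>\<omega>. h (X 0 \<omega>)) borel (\<lambda>\<omega>. (\<beta> t \<omega>)\<^sup>2)"
        by (rule indep_var_compose[OF iv, of h borel "\<lambda>x. x\<^sup>2" borel, unfolded comp_def]) auto
      note j1 = indep_var_integrable[OF i1 b1(1) c1(1)] indep_var_lebesgue_integral[OF i1 b1(1) c1(1)]
      note j2 = indep_var_integrable[OF i2 b1(2) c1(2)] indep_var_lebesgue_integral[OF i2 b1(2) c1(2)]
      show "integrable \<Omega> (\<lambda>\<omega>. \<psi> (X 0 \<omega>) * W \<omega>)"
        using j1(1) by (rule integrable_cong_AE_imp) (use \<beta>W in auto)
      show "integrable \<Omega> (\<lambda>\<omega>. h (X 0 \<omega>) * (W \<omega>)\<^sup>2)"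
        using j2(1) by (rule integrable_cong_AE_imp) (use \<beta>W in auto)
      have "expectation (\<lambda>\<omega>. \<psi> (X 0 \<omega>) * W \<omega>) = expectation (\<lambda>\<omega>. \<psi> (X 0 \<omega>) * \<beta> t \<omega>)"
        by (rule integral_cong_AE) (use \<beta>W in auto)
      then show "expectation (\<lambda>\<omega>. \<psi> (X 0 \<omega>) * W \<omega>) = 0" using j1(2) c1 by simp
      have "expectation (\<lambda>\<omega>. h (X 0 \<omega>) * (W \<omega>)\<^sup>2) = expectation (\<lambda>\<omega>. h (X 0 \<omega>) * (\<beta> t \<omega>)\<^sup>2)"
        by (rule integral_cong_AE) (use \<beta>W in auto)
      then show "expectation (\<lambda>\<omega>. h (X 0 \<omega>) * (W \<omega>)\<^sup>2) = H * t"
        using j2(2) c1 E[of 0 h] by (simp add: H_def)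
    qed
    have AI: "integrable \<Omega> (\<lambda>\<omega>. \<psi> (X t \<omega>) * A t \<omega>)"
    proof (rule integrable_const_bound[where B="C * (K * t)"])
      show "AE \<omega> in \<Omega>. norm (\<psi> (X t \<omega>) * A t \<omega>) \<le> C * (K * t)"
        unfolding norm_mult using \<psi>C Ab t C by (intro AE_I2 mult_mono) auto
    qed simp
    \<comment> \<open>In the mean of \<open>r\<close> the two values of \<open>\<phi>\<close> cancel
      by stationarity and the term linear in \<open>W\<close> vanishes by independence; what is left
      is the quantity to be bounded, up to sign.\<close>
    define r where "r \<omega> = \<phi> (X t \<omega>) - \<phi> (X 0 \<omega>) - \<sigma> * (\<psi> (X 0 \<omega>) * W \<omega>)
        - \<sigma>\<^sup>2 / 2 * (h (X 0 \<omega>) * (W \<omega>)\<^sup>2) - \<psi> (X t \<omega>) * A t \<omega>" for \<omega>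
    have rI: "integrable \<Omega> r" unfolding r_def using \<phi>I t iv1 iv2 AI by auto
    have "expectation r = - (\<sigma>\<^sup>2 / 2 * t * H + expectation (\<lambda>\<omega>. \<psi> (X t \<omega>) * A t \<omega>))"
      unfolding r_def using \<phi>I t iv1 iv2 AI E[of t \<phi>] E[of 0 \<phi>] by simp
    then have "\<bar>\<sigma>\<^sup>2 / 2 * t * H + expectation (\<lambda>\<omega>. \<psi> (X t \<omega>) * A t \<omega>)\<bar> = \<bar>expectation r\<bar>" by simp
    also have "\<dots> \<le> expectation (\<lambda>\<omega>. \<bar>r \<omega>\<bar>)" by (rule integral_abs_bound)
    also have "\<dots> \<le> expectation (\<lambda>\<omega>. C * (K * t)\<^sup>2 + C * \<bar>\<sigma>\<bar> ^ 3 * \<bar>W \<omega>\<bar> ^ 3)"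
    proof (rule integral_mono_AE)
      show "AE \<omega> in \<Omega>. \<bar>r \<omega>\<bar> \<le> C * (K * t)\<^sup>2 + C * \<bar>\<sigma>\<bar> ^ 3 * \<bar>W \<omega>\<bar> ^ 3"
        using sde' \<beta>W
      proof eventually_elim
        case (elim \<omega>)
        have Xt: "X t \<omega> = X 0 \<omega> + A t \<omega> + \<sigma> * W \<omega>" 
          unfolding elim(2)[symmetric] by (rule elim(1)[rule_format]) (use t in simp)
        \<comment> \<open>Expanding at \<open>X t\<close> with increment \<open>- A t\<close> lands
          on \<open>X 0 + \<sigma> * W\<close>, so that the second expansion starts at
          \<open>X 0\<close>, which is independent of its increment.\<close>
        have "\<bar>\<phi> (X t \<omega> + - A t \<omega>) - \<phi> (X t \<omega>) - \<psi> (X t \<omega>) * - A t \<omega>\<bar> \<le> C * (- A t \<omega>)\<^sup>2"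
          by (rule first_order_taylor_bound[OF \<phi> \<psi> hC])
        also have "\<dots> \<le> C * (K * t)\<^sup>2"
          using Ab[of t \<omega>] t C K by (intro mult_left_mono) (auto intro: abs_le_square_iff[THEN iffD1])
        finally have 1: "\<bar>\<phi> (X t \<omega> + - A t \<omega>) - \<phi> (X t \<omega>) - \<psi> (X t \<omega>) * - A t \<omega>\<bar> \<le> C * (K * t)\<^sup>2" .
        have "\<bar>\<phi> (X 0 \<omega> + \<sigma> * W \<omega>) - \<phi> (X 0 \<omega>) - \<psi> (X 0 \<omega>) * (\<sigma> * W \<omega>) - h (X 0 \<omega>) * (\<sigma> * W \<omega>)\<^sup>2 / 2\<bar>
            \<le> C * \<bar>\<sigma> * W \<omega>\<bar> ^ 3"
          by (rule second_order_taylor_bound[OF \<phi> \<psi> lip])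
        also have "\<dots> = C * \<bar>\<sigma>\<bar> ^ 3 * \<bar>W \<omega>\<bar> ^ 3" by (simp add: abs_mult power_mult_distrib)
        finally have 2: "\<bar>\<phi> (X 0 \<omega> + \<sigma> * W \<omega>) - \<phi> (X 0 \<omega>) - \<psi> (X 0 \<omega>) * (\<sigma> * W \<omega>)
            - h (X 0 \<omega>) * (\<sigma> * W \<omega>)\<^sup>2 / 2\<bar> \<le> C * \<bar>\<sigma>\<bar> ^ 3 * \<bar>W \<omega>\<bar> ^ 3" .
        have "X t \<omega> + - A t \<omega> = X 0 \<omega> + \<sigma> * W \<omega>" using Xt by simp
        then have "r \<omega> = (\<phi> (X 0 \<omega> + \<sigma> * W \<omega>) - \<phi> (X 0 \<omega>) - \<psi> (X 0 \<omega>) * (\<sigma> * W \<omega>)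
              - h (X 0 \<omega>) * (\<sigma> * W \<omega>)\<^sup>2 / 2)
            - (\<phi> (X t \<omega> + - A t \<omega>) - \<phi> (X t \<omega>) - \<psi> (X t \<omega>) * - A t \<omega>)"
          by (simp add: r_def power_mult_distrib algebra_simps)
        with 1 2 show ?case by linarith
      qed
    qed (use rI Wm in auto)
    also have "\<dots> \<le> C * (K * t)\<^sup>2 + C * \<bar>\<sigma>\<bar> ^ 3 * (2 * (t * sqrt t))"
      using Wm C by (auto simp: prob_space intro!: mult_left_mono)
    finally show ?thesis .
  qed

  have "\<sigma>\<^sup>2 / 2 * H + I = 0"
  proof (rule eq_zero_if_le_mult_sqrt)
    fix t :: real assume t: "0 < t" "t \<le> 1"
    \<comment> \<open>For \<open>t\<close> at most 1 the terms in \<open>t * t\<close> are absorbed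
      by those in \<open>t * sqrt t\<close>.\<close>
    have "t \<le> sqrt t" using t by (intro real_le_rsqrt) (simp add: power2_eq_square mult_left_le)
    then have tt: "t * t \<le> t * sqrt t" using t by (intro mult_left_mono) auto
    have "\<bar>\<sigma>\<^sup>2 / 2 * H + I\<bar> * t = \<bar>(\<sigma>\<^sup>2 / 2 * H + I) * t\<bar>"
      using t by (simp add: abs_mult)
    also have "(\<sigma>\<^sup>2 / 2 * H + I) * t = \<sigma>\<^sup>2 / 2 * t * H + t * I" by (simp add: algebra_simps)
    also have "\<bar>\<sigma>\<^sup>2 / 2 * t * H + t * I\<bar> \<le> (C * (K * t)\<^sup>2 + C * \<bar>\<sigma>\<bar> ^ 3 * (2 * (t * sqrt t)))
        + t * (C * K * (2 * K * t + \<bar>\<sigma>\<bar> * sqrt t))"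
      using drift[OF t(1)] diffusion[OF t(1)] by linarith
    also have "\<dots> = 3 * C * K\<^sup>2 * (t * t) + (2 * C * \<bar>\<sigma>\<bar> ^ 3 + C * K * \<bar>\<sigma>\<bar>) * (t * sqrt t)"
      by (simp add: power2_eq_square algebra_simps)
    also have "\<dots> \<le> 3 * C * K\<^sup>2 * (t * sqrt t) + (2 * C * \<bar>\<sigma>\<bar> ^ 3 + C * K * \<bar>\<sigma>\<bar>) * (t * sqrt t)"
      by (rule add_right_mono, rule mult_left_mono[OF tt]) (use C in auto)
    also have "\<dots> = (3 * C * K\<^sup>2 + 2 * C * \<bar>\<sigma>\<bar> ^ 3 + C * K * \<bar>\<sigma>\<bar>) * (t * sqrt t)"
      by (simp add: algebra_simps)
    finally show "\<bar>\<sigma>\<^sup>2 / 2 * H + I\<bar> * t \<le> (3 * C * K\<^sup>2 + 2 * C * \<bar>\<sigma>\<bar> ^ 3 + C * K * \<bar>\<sigma>\<bar>) * (t * sqrt t)" .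
  qed
  then show ?thesis by (simp add: H_def I_def g_def)
qed

section \<open>The differential equation for the distribution function\<close>

lemma has_real_derivative_pos_part_power:
  "((\<lambda>x::real. max 0 x ^ Suc (Suc k)) has_real_derivative real (Suc (Suc k)) * max 0 x ^ Suc k) (at x)"
proof (cases "x = 0")
  case False
  then consider "x > 0" | "x < 0" by linarith
  then show ?thesis
  proof cases
    case 1
    have "((\<lambda>x::real. x ^ Suc (Suc k)) has_real_derivative real (Suc (Suc k)) * max 0 x ^ Suc k) (at x)"
      using 1 DERIV_pow[of "Suc (Suc k)" x] by (simp add: max_def)
    then show ?thesis
      by (rule has_field_derivative_transform_within_open[where S="{0<..}"]) (use 1 in auto)
  next
    case 2
    have "((\<lambda>x::real. 0) has_real_derivative real (Suc (Suc k)) * max 0 x ^ Suc k) (at x)"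
      using 2 by (auto simp: max_def)
    then show ?thesis
      by (rule has_field_derivative_transform_within_open[where S="{..<0}"]) (use 2 in auto)
  qed
next
  case True
  have "((\<lambda>h::real. max 0 h ^ Suc (Suc k) / h) \<longlongrightarrow> 0) (at 0)"
  proof (rule tendsto_0_le[where K=1])
    show "((\<lambda>h::real. max 0 h ^ Suc k) \<longlongrightarrow> 0) (at 0)"
      by (auto intro!: tendsto_eq_intros)
    show "\<forall>\<^sub>F h::real in at 0. norm (max 0 h ^ Suc (Suc k) / h) \<le> norm (max 0 h ^ Suc k) * 1"
      by (rule always_eventually) (auto simp: max_def)
  qed
  then show ?thesis using True by (simp add: DERIV_def)
qed

text \<open>Difference quotients of \<open>max 0 y ^ (k + 1) / (k + 1)!\<close>: differences of their translates are
  explicit \<open>C\<^sup>2\<close> test functions whose second derivatives (the case \<open>k = 0\<close>) are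
  trapezoids approximating indicators of intervals.\<close>

definition pos_quotient :: "nat \<Rightarrow> real \<Rightarrow> real \<Rightarrow> real" where
  "pos_quotient k \<epsilon> y = (max 0 y ^ Suc k - max 0 (y - \<epsilon>) ^ Suc k) / (real (fact (Suc k)) * \<epsilon>)"

text \<open>The factorial in \<open>pos_quotient\<close> makes differentiation lower the index by
  one without a constant, so the indices 2, 1 and 0 serve as test function, first and second
  derivative.\<close>

lemma pos_quotient_deriv:
  assumes "\<epsilon> > 0"
  shows "((\<lambda>x. pos_quotient (Suc k) \<epsilon> (x - a)) has_real_derivative pos_quotient k \<epsilon> (x - a)) (at x)"
proof -
  have 1: "((\<lambda>x. max 0 (x - d) ^ Suc (Suc k)) has_real_derivative real (Suc (Suc k)) * max 0 (x - d) ^ Suc k) (at x)" for d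
  proof -
    have "((\<lambda>x. x - d) has_real_derivative 1) (at x)" by (auto intro!: derivative_eq_intros)
    from DERIV_chain2[where g="\<lambda>x. x - d" and f="\<lambda>x. max 0 x ^ Suc (Suc k)",
        OF has_real_derivative_pos_part_power this]
    show ?thesis by simp
  qed
  show ?thesis
    unfolding pos_quotient_def diff_diff_eq
  proof (rule DERIV_cong[OF DERIV_cdivide[OF DERIV_diff[OF 1[of a] 1[of "a + \<epsilon>"]]]])
    have f: "real (fact (Suc (Suc k))) = real (Suc (Suc k)) * real (fact (Suc k))"
      by (simp only: fact_Suc[of "Suc k"] of_nat_mult of_nat_id)
    show "(real (Suc (Suc k)) * max 0 (x - a) ^ Suc k - real (Suc (Suc k)) * max 0 (x - (a + \<epsilon>)) ^ Suc k)
        / (real (fact (Suc (Suc k))) * \<epsilon>)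
      = (max 0 (x - a) ^ Suc k - max 0 (x - (a + \<epsilon>)) ^ Suc k) / (real (fact (Suc k)) * \<epsilon>)"
      unfolding f right_diff_distrib[symmetric] mult.assoc by (rule mult_divide_mult_cancel_left) simp
  qed
qed

text \<open>The function is a ramp from 0 to 1 of slope \<open>1 / \<epsilon>\<close>. That its
  Lipschitz constant blows up is harmless: the weak equation is used at fixed
  \<open>\<epsilon>\<close>, and only the bounds 0 and 1 have to be uniform.\<close>

lemma pos_quotient_0_bounds:
  assumes "\<epsilon> > 0"
  shows "0 \<le> pos_quotient 0 \<epsilon> y" "pos_quotient 0 \<epsilon> y \<le> 1"
    "\<bar>pos_quotient 0 \<epsilon> x - pos_quotient 0 \<epsilon> y\<bar> \<le> 2 / \<epsilon> * \<bar>x - y\<bar>"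
  subgoal using assms by (auto simp: pos_quotient_def max_def field_simps)
  subgoal using assms by (auto simp: pos_quotient_def max_def field_simps)
  subgoal
  proof -
    have "pos_quotient 0 \<epsilon> x - pos_quotient 0 \<epsilon> y
        = ((max 0 x - max 0 y) - (max 0 (x - \<epsilon>) - max 0 (y - \<epsilon>))) / \<epsilon>"
      by (simp add: pos_quotient_def diff_divide_distrib)
    then have "\<bar>pos_quotient 0 \<epsilon> x - pos_quotient 0 \<epsilon> y\<bar>
        = \<bar>(max 0 x - max 0 y) - (max 0 (x - \<epsilon>) - max 0 (y - \<epsilon>))\<bar> / \<epsilon>"
      using assms by simp
    also have "\<dots> \<le> (2 * \<bar>x - y\<bar>) / \<epsilon>"
      using assms by (intro divide_right_mono) (auto simp: max_def abs_if split: if_splits)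
    finally show ?thesis by simp
  qed
  done

text \<open>\<open>pos_quotient 1 \<epsilon> y\<close> is the mean of \<open>max 0\<close> over the
  interval from \<open>y - \<epsilon>\<close> to \<open>y\<close>. The two bounds yield both the
  convergence and a domination uniform in \<open>\<epsilon>\<close>.\<close>

lemma pos_quotient_1_bounds:
  assumes "\<epsilon> > 0"
  shows "max 0 y - \<epsilon> \<le> pos_quotient 1 \<epsilon> y" "pos_quotient 1 \<epsilon> y \<le> max 0 y"
proof -
  consider "y \<le> 0" | "0 < y" "y \<le> \<epsilon>" | "y > \<epsilon>" by linarith
  then have "max 0 y - \<epsilon> \<le> pos_quotient 1 \<epsilon> y \<and> pos_quotient 1 \<epsilon> y \<le> max 0 y"
  proof cases
    case 1 then show ?thesis using assms by (simp add: pos_quotient_def max_def)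
  next
    case 2
    then have eq: "pos_quotient 1 \<epsilon> y = y\<^sup>2 / (2 * \<epsilon>)"
      by (simp add: pos_quotient_def max_def power2_eq_square)
    have "y\<^sup>2 \<le> y * \<epsilon>" using 2 by (simp add: power2_eq_square)
    also have "\<dots> \<le> y * (2 * \<epsilon>)" using 2 assms by simp
    finally show ?thesis unfolding eq using 2 assms
      by (auto simp: divide_le_eq intro: order_trans[of _ 0])
  next
    case 3
    then have "pos_quotient 1 \<epsilon> y = y - \<epsilon> / 2" using assms
      by (simp add: pos_quotient_def max_def field_simps power2_eq_square)
    then show ?thesis using 3 assms by simp
  qed
  then show "max 0 y - \<epsilon> \<le> pos_quotient 1 \<epsilon> y" "pos_quotient 1 \<epsilon> y \<le> max 0 y" by auto
qed

text \<open>At \<open>y = 0\<close> every term vanishes, whence the open half-line. Differences of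
  translates then converge to the indicator of \<open>{a<..b}\<close>, the interval measured by a
  difference of values of the distribution function.\<close>

lemma pos_quotient_0_LIMSEQ:
  "(\<lambda>n. pos_quotient 0 (1 / real (Suc n)) y) \<longlonglongrightarrow> indicator {0<..} y"
proof (cases "y > 0")
  case True
  then obtain N where N: "inverse (real (Suc N)) < y" using reals_Archimedean by blast
  have "\<forall>\<^sub>F n in sequentially. pos_quotient 0 (1 / real (Suc n)) y = 1"
    using eventually_ge_at_top[of N]
  proof eventually_elim
    case (elim n)
    then have "1 / real (Suc n) \<le> inverse (real (Suc N))" by (simp add: field_simps)
    with N have *: "1 / real (Suc n) \<le> y" by linarith
    then have "max 0 (y - 1 / real (Suc n)) = y - 1 / real (Suc n)" by simp
    then show ?case using True by (simp add: pos_quotient_def)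
  qed
  then show ?thesis using True by (simp add: tendsto_eventually)
next
  case False
  then have "max 0 (y - 1 / real (Suc n)) = 0" for n
  proof -
    have "1 / real (Suc n) > 0" by simp
    with False show ?thesis by linarith
  qed
  then have "pos_quotient 0 (1 / real (Suc n)) y = 0" for n
    using False by (simp add: pos_quotient_def)
  with False show ?thesis by simp
qed

lemma pos_quotient_1_LIMSEQ:
  "(\<lambda>n. pos_quotient 1 (1 / real (Suc n)) y) \<longlonglongrightarrow> max 0 y"
proof (rule real_tendsto_sandwich)
  show "(\<lambda>n. max 0 y - 1 / real (Suc n)) \<longlonglongrightarrow> max 0 y"
    using tendsto_diff[OF tendsto_const[of "max 0 y"] LIMSEQ_inverse_real_of_nat] by (simp add: inverse_eq_divide)
  show "\<forall>\<^sub>F n in sequentially. max 0 y - 1 / real (Suc n) \<le> pos_quotient 1 (1 / real (Suc n)) y"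
    "\<forall>\<^sub>F n in sequentially. pos_quotient 1 (1 / real (Suc n)) y \<le> max 0 y"
    by (intro always_eventually allI pos_quotient_1_bounds; simp)+
qed (rule tendsto_const)

text \<open>\<open>H 0 n\<close> is a trapezoid tending to the indicator of \<open>{a<..b}\<close>.
  Its antiderivative \<open>H 1 n\<close> is bounded but stays equal to \<open>b - a\<close> far to
  the right, so \<open>H 2 n\<close> grows linearly; \<open>weak\<close> accordingly asks for no
  bound on \<open>\<phi>\<close>.\<close>

lemma weak_equation_interval:
  fixes \<mu> :: "real measure" and g :: "real \<Rightarrow> real"
  assumes "real_distribution \<mu>"
    and gm: "g \<in> borel_measurable borel" and gb: "\<And>x. \<bar>g x\<bar> \<le> K"
    and weak: "\<And>\<phi> \<psi> h C. (\<And>x. (\<phi> has_real_derivative \<psi> x) (at x)) \<Longrightarrow>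
        (\<And>x. (\<psi> has_real_derivative h x) (at x)) \<Longrightarrow> (\<And>x. \<bar>\<psi> x\<bar> \<le> C) \<Longrightarrow> (\<And>x. \<bar>h x\<bar> \<le> C) \<Longrightarrow>
        (\<And>x y. \<bar>h x - h y\<bar> \<le> C * \<bar>x - y\<bar>) \<Longrightarrow>
        (\<integral>x. h x \<partial>\<mu>) = - c * (\<integral>x. \<psi> x * g x \<partial>\<mu>)"
    and ab: "a < b"
  shows "measure \<mu> {a<..b} = - c * (\<integral>x. (max 0 (x - a) - max 0 (x - b)) * g x \<partial>\<mu>)"
proof -
  interpret real_distribution \<mu> by fact
  define e where "e n = 1 / real (Suc n)" for n
  have e: "e n > 0" "e n \<le> 1" for n by (auto simp: e_def)
  define H where "H k n x = pos_quotient k (e n) (x - a) - pos_quotient k (e n) (x - b)" for k n x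
  have H': "((\<lambda>x. H (Suc k) n x) has_real_derivative H k n x) (at x)" for k n x
    unfolding H_def by (intro derivative_intros pos_quotient_deriv e)
  have H0b: "\<bar>H 0 n x\<bar> \<le> 1" for n x
    using pos_quotient_0_bounds(1,2)[OF e(1)[of n], of "x - a"] pos_quotient_0_bounds(1,2)[OF e(1)[of n], of "x - b"]
    unfolding H_def by linarith
  have H1b: "\<bar>H 1 n x\<bar> \<le> b - a + 1" for n x
    using pos_quotient_1_bounds[OF e(1)[of n], of "x - a"] pos_quotient_1_bounds[OF e(1)[of n], of "x - b"] e(2)[of n] ab
    unfolding H_def by (simp add: max_def split: if_splits)
  have H0l: "\<bar>H 0 n x - H 0 n y\<bar> \<le> 4 / e n * \<bar>x - y\<bar>" for n x y
    using pos_quotient_0_bounds(3)[OF e(1)[of n], where x="x - a" and y="y - a"]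
      pos_quotient_0_bounds(3)[OF e(1)[of n], where x="x - b" and y="y - b"]
    unfolding H_def by (simp add: abs_le_iff)
  have weakH: "(\<integral>x. H 0 n x \<partial>\<mu>) = - c * (\<integral>x. H 1 n x * g x \<partial>\<mu>)" for n
  \<comment> \<open>\<open>C\<close> may depend on \<open>n\<close>, since it does not occur in the
    conclusion of \<open>weak\<close>. The summand \<open>4 / e n\<close> serves the Lipschitz
    condition, the rest the bounds of \<open>H 1 n\<close> and \<open>H 0 n\<close>.\<close>
  proof (rule weak[where \<phi>="H 2 n" and C="4 / e n + (b - a) + 1"])
    show "(H 2 n has_real_derivative H 1 n x) (at x)" for x using H'[of 1] by (simp add: numeral_2_eq_2)
    show "(H 1 n has_real_derivative H 0 n x) (at x)" for x using H'[of 0] by simp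
    have e4: "0 \<le> 4 / e n" using e(1)[of n] by simp
    show "\<bar>H 1 n x\<bar> \<le> 4 / e n + (b - a) + 1" for x using H1b[of n x] e4 by linarith
    show "\<bar>H 0 n x\<bar> \<le> 4 / e n + (b - a) + 1" for x using H0b[of n x] e4 ab by linarith
    show "\<bar>H 0 n x - H 0 n y\<bar> \<le> (4 / e n + (b - a) + 1) * \<bar>x - y\<bar>" for x y
      by (rule order_trans[OF H0l[of n x y] mult_right_mono]) (use ab in auto)
  qed
  have m[measurable]: "H k n \<in> borel_measurable borel" for k n
    unfolding H_def pos_quotient_def by measurable
  have l0: "(\<lambda>n. \<integral>x. H 0 n x \<partial>\<mu>) \<longlonglongrightarrow> (\<integral>x. indicator {a<..b} x \<partial>\<mu>)"
  proof (rule integral_dominated_convergence[where w="\<lambda>_. 1"])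
    show "AE x in \<mu>. (\<lambda>n. H 0 n x) \<longlonglongrightarrow> indicator {a<..b} x"
    proof (rule AE_I2)
      fix x
      have "(\<lambda>n. H 0 n x) \<longlonglongrightarrow> indicator {0<..} (x - a) - indicator {0<..} (x - b)"
        unfolding H_def e_def by (intro tendsto_diff pos_quotient_0_LIMSEQ)
      moreover have "indicator {0<..} (x - a) - indicator {0<..} (x - b) = (indicator {a<..b} x :: real)"
        using ab by (auto split: split_indicator)
      ultimately show "(\<lambda>n. H 0 n x) \<longlonglongrightarrow> indicator {a<..b} x" by simp
    qed
    show "H 0 n \<in> borel_measurable \<mu>" "indicator {a<..b} \<in> borel_measurable \<mu>" for n by measurable
  qed (use H0b in auto)
  have l1: "(\<lambda>n. \<integral>x. H 1 n x * g x \<partial>\<mu>) \<longlonglongrightarrow> (\<integral>x. (max 0 (x - a) - max 0 (x - b)) * g x \<partial>\<mu>)"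
  proof (rule integral_dominated_convergence[where w="\<lambda>_. (b - a + 1) * K"])
    show "AE x in \<mu>. (\<lambda>n. H 1 n x * g x) \<longlonglongrightarrow> (max 0 (x - a) - max 0 (x - b)) * g x"
      unfolding H_def e_def by (intro AE_I2 tendsto_mult_right tendsto_diff pos_quotient_1_LIMSEQ)
    show "AE x in \<mu>. norm (H 1 n x * g x) \<le> (b - a + 1) * K" for n
      unfolding norm_mult using H1b gb ab by (intro AE_I2 mult_mono) auto
    show "(\<lambda>x. H 1 n x * g x) \<in> borel_measurable \<mu>"
      "(\<lambda>x. (max 0 (x - a) - max 0 (x - b)) * g x) \<in> borel_measurable \<mu>" for n
      using gm by measurable
  qed auto
  have "(\<lambda>n. \<integral>x. H 0 n x \<partial>\<mu>) \<longlonglongrightarrow> - c * (\<integral>x. (max 0 (x - a) - max 0 (x - b)) * g x \<partial>\<mu>)"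
    unfolding weakH by (intro tendsto_mult_left l1)
  from LIMSEQ_unique[OF l0 this] show ?thesis by simp
qed

text \<open>\<open>max 0 (x - a) - max 0 (x - b)\<close> is the length of the part of
  \<open>{a..b}\<close> to the left of \<open>x\<close>. Writing it as an integral over
  \<open>y\<close> and exchanging the integrals exhibits a density of \<open>\<mu>\<close>.\<close>

lemma weak_equation_density:
  fixes \<mu> :: "real measure" and g :: "real \<Rightarrow> real"
  assumes "real_distribution \<mu>"
    and gm[measurable]: "g \<in> borel_measurable borel" and gb: "\<And>x. \<bar>g x\<bar> \<le> K"
    and I: "measure \<mu> {a<..b} = - c * (\<integral>x. (max 0 (x - a) - max 0 (x - b)) * g x \<partial>\<mu>)"
    and ab: "a < b"
  shows "measure \<mu> {a<..b} = (LBINT y:{a..b}. - c * (\<integral>x. indicator {y<..} x * g x \<partial>\<mu>))"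
proof -
  interpret real_distribution \<mu> by fact
  interpret P: pair_sigma_finite lborel \<mu> ..
  have K: "K \<ge> 0" using gb[of 0] by simp
  define f where "f y x = indicator {a..b} y * (indicator {y<..} x * g x)" for y x :: real
  have "case_prod f = (\<lambda>p. indicator {a..b} (fst p) * ((if fst p < snd p then 1 else 0) * g (snd p)))"
    by (auto simp: f_def split: split_indicator)
  also have "\<dots> \<in> borel_measurable (lborel \<Otimes>\<^sub>M \<mu>)" by measurable
  finally have fm: "case_prod f \<in> borel_measurable (lborel \<Otimes>\<^sub>M \<mu>)" .
  have fI: "integrable (lborel \<Otimes>\<^sub>M \<mu>) (case_prod f)"
  proof (rule integrableI_bounded_set[where A="{a..b} \<times> UNIV" and B=K])
    show "emeasure (lborel \<Otimes>\<^sub>M \<mu>) ({a..b} \<times> UNIV) < \<infinity>"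
      using ab emeasure_space_1 by (simp add: emeasure_pair_measure_Times)
    show "AE x in lborel \<Otimes>\<^sub>M \<mu>. x \<in> {a..b} \<times> UNIV \<longrightarrow> norm (case_prod f x) \<le> K"
      by (rule AE_I2) (use gb K in \<open>auto simp: f_def split: split_indicator\<close>)
    show "AE x in lborel \<Otimes>\<^sub>M \<mu>. x \<notin> {a..b} \<times> UNIV \<longrightarrow> case_prod f x = 0"
      by (rule AE_I2) (auto simp: f_def split: split_indicator_asm)
  qed (use fm in auto)
  have inner: "(\<integral>y. f y x \<partial>lborel) = (max 0 (x - a) - max 0 (x - b)) * g x" for x
  proof -
    have "(\<integral>y. f y x \<partial>lborel) = (\<integral>y. indicator ({a..b} \<inter> {..<x}) y * g x \<partial>lborel)"
      by (intro Bochner_Integration.integral_cong) (auto simp: f_def split: split_indicator)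
    also have "\<dots> = measure lborel ({a..b} \<inter> {..<x}) * g x" by simp
    also have "measure lborel ({a..b} \<inter> {..<x}) = max 0 (x - a) - max 0 (x - b)"
    proof -
      have "{a..b} \<inter> {..<x} = (if x \<le> a then {} else if x \<le> b then {a..<x} else {a..b})" by auto
      then show ?thesis using ab by simp
    qed
    finally show ?thesis .
  qed
  have "(LBINT y:{a..b}. - c * (\<integral>x. indicator {y<..} x * g x \<partial>\<mu>)) = - c * (\<integral>y. \<integral>x. f y x \<partial>\<mu> \<partial>lborel)"
  proof -
    have "indicator {a..b} y *\<^sub>R (- c * (\<integral>x. indicator {y<..} x * g x \<partial>\<mu>)) = - c * (\<integral>x. f y x \<partial>\<mu>)" for y
      unfolding f_def integral_mult_right_zero by simp
    then show ?thesis
      unfolding set_lebesgue_integral_def by (simp only: integral_mult_right_zero)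
  qed
  also have "(\<integral>y. \<integral>x. f y x \<partial>\<mu> \<partial>lborel) = (\<integral>x. \<integral>y. f y x \<partial>lborel \<partial>\<mu>)"
    by (rule P.Fubini_integral[OF fI, symmetric])
  finally show ?thesis unfolding inner I by simp
qed

section \<open>The probability integral transform\<close>

text \<open>By monotonicity and continuity the level set is a half-line \<open>{..Sup S}\<close>,
  and the intermediate value theorem gives the value \<open>u\<close> at its end. For
  \<open>u = 1\<close> it is the whole line, hence the separate case; it can be empty only for
  \<open>u = 0\<close>.\<close>

lemma (in real_distribution) measure_cdf_le:
  assumes cont: "continuous_on UNIV (cdf M)" and u: "0 \<le> u" "u \<le> 1"
  shows "measure M {x. cdf M x \<le> u} = u"
proof (cases "u = 1")
  case True
  then show ?thesis using cdf_bounded_prob prob_space by (simp add: space_eq_univ[symmetric] del: space_eq_univ)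
next
  case False
  then have u1: "u < 1" using u by simp
  define S where "S = {x. cdf M x \<le> u}"
  have "\<forall>\<^sub>F x in at_top. cdf M x > u"
    using order_tendstoD(1)[OF cdf_lim_at_top_prob u1] .
  then obtain z where z: "cdf M z > u" unfolding eventually_at_top_linorder by auto
  have Sz: "x < z" if "x \<in> S" for x
    using that z cdf_nondecreasing[of z x] by (force simp: S_def)
  show ?thesis
  proof (cases "S = {}")
    case True
    have "\<not> 0 < u"
    proof
      assume "0 < u"
      from order_tendstoD(2)[OF cdf_lim_at_bot this] obtain y where "cdf M y < u"
        unfolding eventually_at_bot_linorder by auto
      then have "y \<in> S" by (simp add: S_def)
      with True show False by simp
    qed
    with True u show ?thesis by (simp add: S_def)
  next
    case False
    have "closed S" unfolding S_def using cont by (intro closed_Collect_le continuous_intros)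
    moreover have bdd: "bdd_above S" using Sz by (intro bdd_aboveI[of _ z]) (auto intro: less_imp_le)
    ultimately have s: "Sup S \<in> S" using False closed_contains_Sup by blast
    have S: "S = {..Sup S}"
    proof
      show "S \<subseteq> {..Sup S}" using bdd by (auto intro: cSup_upper)
      show "{..Sup S} \<subseteq> S"
      proof
        fix x assume "x \<in> {..Sup S}"
        then have "cdf M x \<le> cdf M (Sup S)" by (intro cdf_nondecreasing) simp
        then show "x \<in> S" using s by (simp add: S_def)
      qed
    qed
    have "cdf M (Sup S) = u"
    proof -
      obtain x where x: "Sup S \<le> x" "cdf M x = u"
        using IVT'[of "cdf M" "Sup S" u z] s z Sz[OF s] continuous_on_subset[OF cont]
        by (auto simp: S_def)
      then have "x \<in> S" by (simp add: S_def)
      then have "x \<le> Sup S" using bdd by (rule cSup_upper)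
      with x show ?thesis by simp
    qed
    then show ?thesis using S unfolding cdf_def S_def by metis
  qed
qed

lemma (in real_distribution) distr_cdf_uniform:
  assumes cont: "continuous_on UNIV (cdf M)"
  shows "distr M borel (cdf M) = density lborel (indicator {0..1})"
proof (rule cdf_unique)
  have [measurable]: "cdf M \<in> borel_measurable borel" using cont by (rule borel_measurable_continuous_onI)
  show "real_distribution (distr M borel (cdf M))" by (rule real_distribution_distr) simp
  have "prob_space (density lborel (indicator {0..1::real}))"
    by (rule prob_spaceI) (simp add: emeasure_restricted)
  then show "real_distribution (density lborel (indicator {0..1::real}))"
    by (simp add: real_distribution_def real_distribution_axioms_def)
  show "cdf (distr M borel (cdf M)) = cdf (density lborel (indicator {0..1}))"
  proof
    fix u :: real
    have "{0..1} \<inter> {..u} = {0..min 1 u}" by auto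
    then have r: "cdf (density lborel (indicator {0..1})) u = max 0 (min 1 u)"
      by (simp add: cdf_def measure_def emeasure_restricted emeasure_lborel_Icc_eq max_def)
    have l: "cdf (distr M borel (cdf M)) u = measure M {x. cdf M x \<le> u}"
      unfolding cdf_def[of "distr M borel (cdf M)"] by (simp add: measure_distr vimage_def)
    consider "u < 0" | "0 \<le> u" "u \<le> 1" | "u > 1" by linarith
    then show "cdf (distr M borel (cdf M)) u = cdf (density lborel (indicator {0..1})) u"
      unfolding l r
    proof cases
      case 1
      then have "{x. cdf M x \<le> u} = {}" using cdf_nonneg by (auto simp: not_le intro: less_le_trans)
      then show "measure M {x. cdf M x \<le> u} = max 0 (min 1 u)" using 1 by simp
    next
      case 2
      then show "measure M {x. cdf M x \<le> u} = max 0 (min 1 u)" using measure_cdf_le[OF cont] by simp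
    next
      case 3
      then have "{x. cdf M x \<le> u} = space M" using cdf_bounded_prob by (auto intro: order_trans less_imp_le)
      then show "measure M {x. cdf M x \<le> u} = max 0 (min 1 u)" using 3 prob_space by simp
    qed
  qed
qed

text \<open>The right-hand sides do not mention \<open>M\<close>. This evaluates the drift integral,
  and later allows two measures to be compared through functions of their own distribution
  functions.\<close>

lemma (in real_distribution)
  fixes f :: "real \<Rightarrow> real"
  assumes cont: "continuous_on UNIV (cdf M)" and f[measurable]: "f \<in> borel_measurable borel"
  shows integrable_compose_cdf: "integrable M (\<lambda>x. f (cdf M x)) \<longleftrightarrow> set_integrable lborel {0..1} f"
    and integral_compose_cdf: "(\<integral>x. f (cdf M x) \<partial>M) = (LBINT u:{0..1}. f u)"
proof -
  have [measurable]: "cdf M \<in> borel_measurable M"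
    using borel_measurable_continuous_onI[OF cont] by simp
  have d: "density lborel (indicator {0..1::real}) = density lborel (\<lambda>x. ennreal (indicator {0..1} x))"
    by (simp add: ennreal_indicator)
  show "integrable M (\<lambda>x. f (cdf M x)) \<longleftrightarrow> set_integrable lborel {0..1} f"
  proof -
    have "integrable M (\<lambda>x. f (cdf M x)) \<longleftrightarrow> integrable (distr M borel (cdf M)) f"
      by (subst integrable_distr_eq) auto
    also have "\<dots> \<longleftrightarrow> set_integrable lborel {0..1} f"
      unfolding distr_cdf_uniform[OF cont] d set_integrable_def by (subst integrable_density) auto
    finally show ?thesis .
  qed
  show "(\<integral>x. f (cdf M x) \<partial>M) = (LBINT u:{0..1}. f u)"
  proof -
    have "(\<integral>x. f (cdf M x) \<partial>M) = (\<integral>u. f u \<partial>distr M borel (cdf M))"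
      by (subst integral_distr) auto
    also have "\<dots> = (LBINT u:{0..1}. f u)"
      unfolding distr_cdf_uniform[OF cont] d set_lebesgue_integral_def by (subst integral_density) auto
    finally show ?thesis .
  qed
qed

text \<open>A stretch to the right of \<open>y\<close> on which \<open>cdf M\<close> stays constant
  is null: by \<open>measure_cdf_le\<close>, the level set of \<open>cdf M y\<close> has the same
  mass as \<open>{..y}\<close>.\<close>

lemma (in real_distribution) AE_cdf_less:
  assumes cont: "continuous_on UNIV (cdf M)"
  shows "AE x in M. y < x \<longrightarrow> cdf M y < cdf M x"
proof -
  have [measurable]: "cdf M \<in> borel_measurable borel" using cont by (rule borel_measurable_continuous_onI)
  have "{..y} \<subseteq> {x. cdf M x \<le> cdf M y}" by (auto intro: cdf_nondecreasing)
  then have "measure M ({x. cdf M x \<le> cdf M y} - {..y}) = measure M {x. cdf M x \<le> cdf M y} - measure M {..y}"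
    by (intro finite_measure_Diff) auto
  also have "\<dots> = 0" using measure_cdf_le[OF cont cdf_nonneg cdf_bounded_prob, of y] by (simp add: cdf_def)
  finally have "{x. cdf M x \<le> cdf M y} - {..y} \<in> null_sets M"
    by (simp add: null_sets_def emeasure_eq_measure)
  from AE_not_in[OF this] show ?thesis by eventually_elim auto
qed

section \<open>Estimates for \<open>B\<close> and \<open>b\<close>, and the differential
  equation\<close>

locale rank_energy =
  fixes B b :: "real \<Rightarrow> real" and c :: real
  assumes c_pos: "c > 0"
    and B_deriv: "\<And>u. u \<in> {0..1} \<Longrightarrow> (B has_real_derivative b u) (at u within {0..1})"
    and b_cont: "continuous_on {0..1} b"
    and B_nonneg: "\<And>u. u \<in> {0..1} \<Longrightarrow> B u \<ge> 0"
    and B_0: "B 0 = 0" and B_1: "B 1 = 0"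
    and B_pos: "\<And>u. u \<in> {0<..<1} \<Longrightarrow> B u > 0"
    and b_0: "b 0 > 0" and b_1: "b 1 < 0"
begin

definition K :: real where "K = (SOME K. \<forall>u\<in>{0..1}. \<bar>b u\<bar> \<le> K)"

lemma b_bound: "u \<in> {0..1} \<Longrightarrow> \<bar>b u\<bar> \<le> K"
proof -
  have "bounded (b ` {0..1})" by (intro compact_imp_bounded compact_continuous_image b_cont) simp
  then have "\<exists>K. \<forall>u\<in>{0..1}. \<bar>b u\<bar> \<le> K" by (auto simp: bounded_iff)
  from someI_ex[OF this] show "u \<in> {0..1} \<Longrightarrow> \<bar>b u\<bar> \<le> K" by (simp add: K_def)
qed

lemma K_nonneg: "K \<ge> 0" using b_bound[of 0] by simp

lemma B_lipschitz: "u \<in> {0..1} \<Longrightarrow> v \<in> {0..1} \<Longrightarrow> \<bar>B u - B v\<bar> \<le> K * \<bar>u - v\<bar>"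
  using field_differentiable_bound[of "{0..1}" B b K u v] B_deriv b_bound by simp

lemma B_le: "u \<in> {0..1} \<Longrightarrow> B u \<le> K * u" "u \<in> {0..1} \<Longrightarrow> B u \<le> K * (1 - u)"
  using B_lipschitz[of u 0] B_lipschitz[of u 1] B_0 B_1 by auto

lemma B_cont: "continuous_on {0..1} B"
  using B_deriv by (meson DERIV_continuous continuous_on_eq_continuous_within)

text \<open>\<open>B\<close> and \<open>b\<close> are controlled on \<open>{0..1}\<close> only.
  Composed with the clamp they are continuous, hence Borel, on the whole line, and nothing changes
  at values of a distribution function.\<close>

definition clamp01 :: "real \<Rightarrow> real" where "clamp01 u = max 0 (min 1 u)"

lemma clamp01: "clamp01 u \<in> {0..1}" "u \<in> {0..1} \<Longrightarrow> clamp01 u = u"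
  by (auto simp: clamp01_def)

lemma clamp01_cont: "continuous_on UNIV clamp01"
  unfolding clamp01_def by (intro continuous_intros)

lemma clamp01_measurable [measurable]: "clamp01 \<in> borel_measurable borel"
  using clamp01_cont by (rule borel_measurable_continuous_onI)

lemma b_clamp01_cont: "continuous_on UNIV (\<lambda>u. b (clamp01 u))"
  by (rule continuous_on_compose2[OF b_cont clamp01_cont]) (use clamp01(1) in blast)

lemma b_clamp01_measurable [measurable]: "(\<lambda>u. b (clamp01 u)) \<in> borel_measurable borel"
  using b_clamp01_cont by (rule borel_measurable_continuous_onI)

lemma B_clamp01_cont: "continuous_on UNIV (\<lambda>u. B (clamp01 u))"
  by (rule continuous_on_compose2[OF B_cont clamp01_cont]) (use clamp01(1) in blast)

lemma B_clamp01_measurable [measurable]: "(\<lambda>u. B (clamp01 u)) \<in> borel_measurable borel"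
  using B_clamp01_cont by (rule borel_measurable_continuous_onI)

lemma cdf_unit:
  assumes "real_distribution \<mu>" shows "cdf \<mu> x \<in> {0..1}"
proof -
  interpret real_distribution \<mu> by fact
  show ?thesis using cdf_nonneg cdf_bounded_prob by simp
qed

lemma cdf_measurable:
  assumes "real_distribution \<mu>" shows "cdf \<mu> \<in> borel_measurable borel"
proof -
  interpret real_distribution \<mu> by fact
  show ?thesis by (intro borel_measurable_mono monoI cdf_nondecreasing)
qed

lemma clamp01_cdf: "real_distribution \<mu> \<Longrightarrow> clamp01 (cdf \<mu> x) = cdf \<mu> x"
  using cdf_unit by (rule clamp01)

lemma b_cdf_measurable: "real_distribution \<mu> \<Longrightarrow> (\<lambda>x. b (cdf \<mu> x)) \<in> borel_measurable borel"
  using measurable_compose[OF cdf_measurable b_clamp01_measurable] by (simp add: clamp01_cdf)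

lemma B_cdf_measurable: "real_distribution \<mu> \<Longrightarrow> (\<lambda>x. B (cdf \<mu> x)) \<in> borel_measurable borel"
  using measurable_compose[OF cdf_measurable B_clamp01_measurable] by (simp add: clamp01_cdf)

text \<open>Under the uniform law the integral is that of \<open>b\<close> over
  \<open>{v..1}\<close>, that is \<open>B 1 - B v\<close>. As \<open>B 1 = 0\<close>, only the value
  of the distribution function at \<open>y\<close> survives, which turns the integral equation into
  a differential one.\<close>

lemma integral_drift_tail:
  assumes "real_distribution \<mu>" and cont: "continuous_on UNIV (cdf \<mu>)"
  shows "(\<integral>x. indicator {y<..} x * b (cdf \<mu> x) \<partial>\<mu>) = - B (cdf \<mu> y)"
proof -
  interpret real_distribution \<mu> by fact
  have [measurable]: "(\<lambda>x. b (cdf \<mu> x)) \<in> borel_measurable borel" "cdf \<mu> \<in> borel_measurable borel"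
    using assms b_cdf_measurable cdf_measurable by auto
  define v where "v = cdf \<mu> y"
  have v: "v \<in> {0..1}" using cdf_unit assms by (simp add: v_def)
  have "(\<integral>x. indicator {y<..} x * b (cdf \<mu> x) \<partial>\<mu>)
      = (\<integral>x. indicator {v<..} (cdf \<mu> x) * b (clamp01 (cdf \<mu> x)) \<partial>\<mu>)"
  proof (rule integral_cong_AE)
    show "AE x in \<mu>. indicator {y<..} x * b (cdf \<mu> x) = indicator {v<..} (cdf \<mu> x) * b (clamp01 (cdf \<mu> x))"
      using AE_cdf_less[OF cont, of y]
    proof eventually_elim
      case (elim x)
      have "v < cdf \<mu> x \<Longrightarrow> y < x" using cdf_nondecreasing[of x y] by (force simp: v_def)
      with elim have "indicator {y<..} x = (indicator {v<..} (cdf \<mu> x) :: real)"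
        by (auto simp: v_def split: split_indicator)
      then show ?case using assms by (simp add: clamp01_cdf)
    qed
  qed measurable
  also have "\<dots> = (LBINT u:{0..1}. indicator {v<..} u * b (clamp01 u))"
    by (rule integral_compose_cdf[OF cont]) measurable
  also have "\<dots> = (\<integral>u. indicator {v..1} u *\<^sub>R b (clamp01 u) \<partial>lborel)"
    unfolding set_lebesgue_integral_def
  proof (rule integral_cong_AE)
    show "AE u in lborel. indicator {0..1} u *\<^sub>R (indicator {v<..} u * b (clamp01 u)) = indicator {v..1} u *\<^sub>R b (clamp01 u)"
      using AE_lborel_singleton[of v] by eventually_elim (use v in \<open>auto split: split_indicator\<close>)
  qed measurable
  also have "\<dots> = B 1 - B v"
  proof (rule integral_FTC_Icc)
    show "v \<le> 1" using v by simp
    fix u assume u: "v \<le> u" "u \<le> 1"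
    have "(B has_real_derivative b u) (at u within {v..1})"
      using B_deriv[of u] u v by (auto intro: has_field_derivative_subset)
    then show "(B has_vector_derivative b (clamp01 u)) (at u within {v..1})"
      using u v by (simp add: has_real_derivative_iff_has_vector_derivative clamp01)
  qed (rule continuous_on_subset[OF b_clamp01_cont], simp)
  finally show ?thesis by (simp add: B_1 v_def)
qed

text \<open>Regularity is gained in stages: boundedness of \<open>b\<close> makes the density
  \<open>p\<close> bounded and \<open>cdf \<mu>\<close> Lipschitz; its continuity permits
  \<open>integral_drift_tail\<close>, which identifies \<open>p\<close> with
  \<open>c * B (cdf \<mu> y)\<close>; thus \<open>p\<close> is continuous and the fundamental
  theorem of calculus applies.\<close>

lemma cdf_ode:
  assumes "real_distribution \<mu>"
    and I: "\<And>u v. u < v \<Longrightarrow> measure \<mu> {u<..v}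
        = (LBINT y:{u..v}. - c * (\<integral>x. indicator {y<..} x * b (cdf \<mu> x) \<partial>\<mu>))"
  shows "(cdf \<mu> has_real_derivative c * B (cdf \<mu> x)) (at x)"
proof -
  interpret real_distribution \<mu> by fact
  have [measurable]: "(\<lambda>x. b (cdf \<mu> x)) \<in> borel_measurable borel"
    using assms b_cdf_measurable by auto
  define p where "p y = - c * (\<integral>x. indicator {y<..} x * b (cdf \<mu> x) \<partial>\<mu>)" for y
  have pb: "\<bar>p y\<bar> \<le> c * K" for y
  proof -
    have "\<bar>\<integral>x. indicator {y<..} x * b (cdf \<mu> x) \<partial>\<mu>\<bar> \<le> (\<integral>x. K \<partial>\<mu>)"
    proof (rule order_trans[OF integral_abs_bound integral_mono'])
      show "\<bar>indicator {y<..} x * b (cdf \<mu> x)\<bar> \<le> K" for x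
        using b_bound[OF cdf_unit[OF assms(1)], of x] K_nonneg by (simp split: split_indicator)
    qed (use K_nonneg in auto)
    then show ?thesis using c_pos prob_space by (simp add: p_def abs_mult)
  qed
  have F: "\<bar>cdf \<mu> v - cdf \<mu> u\<bar> \<le> (c * K) * \<bar>v - u\<bar>" for u v
  proof (induction u v rule: linorder_less_wlog)
    case (less u v)
    have "cdf \<mu> v - cdf \<mu> u = (\<integral>y. indicator {u..v} y * p y \<partial>lborel)"
      using I[OF less] cdf_diff_eq[OF less] by (simp add: p_def set_lebesgue_integral_def)
    also have "\<bar>\<dots>\<bar> \<le> (\<integral>y. indicator {u..v} y * (c * K) \<partial>lborel)"
    proof (rule order_trans[OF integral_abs_bound integral_mono'])
      show "integrable lborel (\<lambda>y. indicator {u..v} y * (c * K))"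
        by (intro integrable_mult_left integrable_real_indicator) (auto simp: emeasure_lborel_Icc_eq)
      show "\<bar>indicator {u..v} y * p y\<bar> \<le> indicator {u..v} y * (c * K)" for y
        using pb by (simp split: split_indicator)
    qed (use c_pos K_nonneg in auto)
    finally show ?case using less by (simp add: mult.commute)
  qed (auto simp: abs_minus_commute)
  have cont: "continuous_on UNIV (cdf \<mu>)"
  proof (rule lipschitz_on_continuous_on)
    show "(c * K)-lipschitz_on UNIV (cdf \<mu>)"
      using F c_pos K_nonneg by (auto simp: lipschitz_on_def dist_real_def)
  qed
  have p: "p y = c * B (cdf \<mu> y)" for y
    unfolding p_def integral_drift_tail[OF assms(1) cont] by simp
  have pc: "continuous_on UNIV p"
  proof -
    have "continuous_on UNIV (\<lambda>y. B (cdf \<mu> y))"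
      by (rule continuous_on_compose2[OF B_cont cont]) (use cdf_unit[OF assms(1)] in auto)
    then show ?thesis unfolding p by (intro continuous_intros)
  qed
  \<comment> \<open>Integration starts at \<open>x - 1\<close> so that \<open>x\<close> is interior
    to the interval and the derivative within it is in the end two-sided.\<close>
  have "((\<lambda>u. LBINT y=(x - 1)..u. p y) has_vector_derivative p x) (at x within {x - 1..x + 1})"
    by (rule interval_integral_FTC2) (auto intro: continuous_on_subset[OF pc])
  then have "((\<lambda>u. cdf \<mu> (x - 1) + (LBINT y=(x - 1)..u. p y)) has_real_derivative p x) (at x within {x - 1..x + 1})"
    unfolding has_real_derivative_iff_has_vector_derivative by (auto intro!: derivative_eq_intros)
  then have "(cdf \<mu> has_real_derivative p x) (at x within {x - 1..x + 1})"
  proof (rule has_field_derivative_transform_within[where d=1])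
    fix u assume u: "u \<in> {x - 1..x + 1}" "dist u x < 1"
    then have "x - 1 < u" by (auto simp: dist_real_def)
    then show "cdf \<mu> (x - 1) + (LBINT y=(x - 1)..u. p y) = cdf \<mu> u"
      using I[of "x - 1" u] cdf_diff_eq[of "x - 1" u] by (simp add: p_def interval_integral_Icc)
  qed auto
  then have "(cdf \<mu> has_real_derivative p x) (at x within {x - 1<..<x + 1})"
    by (rule has_field_derivative_subset) auto
  moreover have "at x within {x - 1<..<x + 1} = at x" by (rule at_within_open) auto
  ultimately show ?thesis unfolding p by simp
qed

end

section \<open>The stationary profile\<close>

lemma integrable_exp_abs:
  fixes a :: real
  assumes "a > 0"
  shows "integrable lborel (\<lambda>x. exp (- a * \<bar>x\<bar>))"
proof -
  have "(\<integral>\<^sup>+x. ennreal (indicator {0..} x *\<^sub>R exp (- a * \<bar>x\<bar>)) \<partial>lborel)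
      = (\<integral>\<^sup>+x. ennreal (exp (- a * x)) * indicator {0..} x \<partial>lborel)"
    by (intro nn_integral_cong) (auto split: split_indicator)
  also have "\<dots> = ennreal (0 - (- (exp (- a * 0) / a)))"
  proof (rule nn_integral_FTC_atLeast)
    show "((\<lambda>x. - (exp (- a * x) / a)) has_real_derivative exp (- a * x)) (at x)" for x
      using assms by (auto intro!: derivative_eq_intros)
    have "((\<lambda>x. exp (- (a * x))) \<longlongrightarrow> 0) at_top"
      using assms by real_asymp
    from tendsto_mult_right[OF this, of "- (1 / a)"]
    show "((\<lambda>x. - (exp (- a * x) / a)) \<longlongrightarrow> 0) at_top"
      by simp
  qed auto
  finally have "has_bochner_integral lborel (\<lambda>x. indicator {0..} x *\<^sub>R exp (- a * \<bar>x\<bar>)) (1 / a)"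
    using assms by (intro has_bochner_integral_nn_integral) auto
  from has_bochner_integral_even_function[OF this] show ?thesis
    by (auto intro: integrable.intros)
qed

text \<open>The first moment and the differential equation are all that is kept of the diffusion
  process from here on.\<close>

locale stationary_profile = rank_energy + real_distribution \<nu> for \<nu> :: "real measure" +
  assumes first_moment: "integrable \<nu> (\<lambda>x. x)"
    and cdf_deriv: "\<And>x. (cdf \<nu> has_real_derivative c * B (cdf \<nu> x)) (at x)"
begin

definition q :: "real \<Rightarrow> real" where "q x = c * B (cdf \<nu> x)"

definition L :: "real \<Rightarrow> real" where "L x = ln (q x)"

lemma is_distribution: "real_distribution \<nu>" ..

lemma cdf_cont: "continuous_on UNIV (cdf \<nu>)"
  using cdf_deriv by (intro continuous_at_imp_continuous_on ballI DERIV_isCont)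

text \<open>A Gronwall argument: \<open>B u \<le> K * u\<close> makes
  \<open>cdf \<nu> x * exp (- (c * K) * x)\<close> nonincreasing, so a zero would propagate to the
  right, against the limit 1.\<close>

lemma cdf_pos: "0 < cdf \<nu> x"
proof -
  obtain z where z: "cdf \<nu> z > 0"
    using order_tendstoD(1)[OF cdf_lim_at_top_prob, of 0] unfolding eventually_at_top_linorder by auto
  show ?thesis
  proof (cases "z \<le> x")
    case True
    then show ?thesis using z cdf_nondecreasing[OF True] by linarith
  next
    case False
    have "cdf \<nu> z * exp (- (c * K) * z) \<le> cdf \<nu> x * exp (- (c * K) * x)"
    proof (rule DERIV_nonpos_imp_nonincreasing[where f="\<lambda>x. cdf \<nu> x * exp (- (c * K) * x)"])
      fix y
      have "((\<lambda>x. cdf \<nu> x * exp (- (c * K) * x)) has_real_derivative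
          c * (B (cdf \<nu> y) - K * cdf \<nu> y) * exp (- (c * K) * y)) (at y)"
        by (auto intro!: derivative_eq_intros cdf_deriv simp: algebra_simps)
      moreover have "c * (B (cdf \<nu> y) - K * cdf \<nu> y) * exp (- (c * K) * y) \<le> 0"
        using B_le(1)[OF cdf_unit[OF is_distribution], of y] c_pos
        by (intro mult_nonpos_nonneg mult_nonneg_nonpos) auto
      ultimately show "\<exists>d. ((\<lambda>x. cdf \<nu> x * exp (- (c * K) * x)) has_real_derivative d) (at y) \<and> d \<le> 0"
        by blast
    qed (use False in simp)
    moreover have "0 < cdf \<nu> z * exp (- (c * K) * z)" using z by simp
    ultimately show ?thesis by (metis exp_gt_zero less_le_trans zero_less_mult_pos2)
  qed
qed

text \<open>The mirror image of \<open>cdf_pos\<close>, based on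
  \<open>B u \<le> K * (1 - u)\<close>.\<close>

lemma cdf_less_1: "cdf \<nu> x < 1"
proof -
  obtain z where z: "cdf \<nu> z < 1"
    using order_tendstoD(2)[OF cdf_lim_at_bot, of 1] unfolding eventually_at_bot_linorder by auto
  show ?thesis
  proof (cases "x \<le> z")
    case True
    then show ?thesis using z cdf_nondecreasing[OF True] by linarith
  next
    case False
    have "(1 - cdf \<nu> z) * exp (c * K * z) \<le> (1 - cdf \<nu> x) * exp (c * K * x)"
    proof (rule DERIV_nonneg_imp_nondecreasing[where f="\<lambda>x. (1 - cdf \<nu> x) * exp (c * K * x)"])
      fix y
      have "((\<lambda>x. (1 - cdf \<nu> x) * exp (c * K * x)) has_real_derivative
          c * (K * (1 - cdf \<nu> y) - B (cdf \<nu> y)) * exp (c * K * y)) (at y)"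
        by (auto intro!: derivative_eq_intros cdf_deriv simp: algebra_simps)
      moreover have "c * (K * (1 - cdf \<nu> y) - B (cdf \<nu> y)) * exp (c * K * y) \<ge> 0"
        using B_le(2)[OF cdf_unit[OF is_distribution], of y] c_pos
        by (intro mult_nonneg_nonneg) auto
      ultimately show "\<exists>d. ((\<lambda>x. (1 - cdf \<nu> x) * exp (c * K * x)) has_real_derivative d) (at y) \<and> d \<ge> 0"
        by blast
    qed (use False in simp)
    moreover have "0 < (1 - cdf \<nu> z) * exp (c * K * z)" using z by simp
    ultimately have "0 < 1 - cdf \<nu> x" by (metis exp_gt_zero less_le_trans zero_less_mult_pos2)
    then show ?thesis by simp
  qed
qed

lemma q_pos: "q x > 0"
  unfolding q_def using B_pos[of "cdf \<nu> x"] cdf_pos cdf_less_1 c_pos by simp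

lemma q_le: "q x \<le> c * K"
proof -
  have "B (cdf \<nu> x) \<le> K * cdf \<nu> x" by (rule B_le(1)[OF cdf_unit[OF is_distribution]])
  also have "\<dots> \<le> K * 1" using cdf_bounded_prob K_nonneg by (intro mult_left_mono) auto
  finally show ?thesis using c_pos by (simp add: q_def)
qed

lemma q_measurable [measurable]: "q \<in> borel_measurable borel"
  unfolding q_def using B_cdf_measurable[OF is_distribution] by measurable

lemma L_measurable [measurable]: "L \<in> borel_measurable borel"
  unfolding L_def by measurable

text \<open>Since \<open>cdf \<nu> x\<close> is interior to the unit interval, the derivative of
  \<open>B\<close> there is two-sided and the chain rule applies; the factor \<open>q x\<close> it
  produces cancels in the logarithmic derivative.\<close>

lemma L_deriv: "(L has_real_derivative c * b (cdf \<nu> x)) (at x)"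
proof -
  have "(B has_real_derivative b (cdf \<nu> x)) (at (cdf \<nu> x) within {0<..<1})"
    using B_deriv[OF cdf_unit[OF is_distribution]] by (rule has_field_derivative_subset) auto
  then have "(B has_real_derivative b (cdf \<nu> x)) (at (cdf \<nu> x))"
    using cdf_pos cdf_less_1 by (subst (asm) at_within_open) auto
  from DERIV_chain2[OF this cdf_deriv]
  have "(q has_real_derivative b (cdf \<nu> x) * q x * c) (at x)"
    unfolding q_def by (auto intro!: derivative_eq_intros)
  then show ?thesis
    unfolding L_def using q_pos[of x] by (auto intro!: derivative_eq_intros)
qed

lemma drift_bound: "\<bar>c * b (cdf \<nu> x)\<bar> \<le> c * K"
  using b_bound[OF cdf_unit[OF is_distribution]] c_pos by (simp add: abs_mult)

lemma \<nu>_density: "\<nu> = density lborel (\<lambda>x. ennreal (q x))"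
proof (rule measure_eqI_lessThan)
  fix x
  show "emeasure \<nu> {x<..} < \<infinity>" by (simp add: emeasure_eq_measure)
  have "emeasure (density lborel (\<lambda>x. ennreal (q x))) {x<..} = (\<integral>\<^sup>+y. ennreal (q y) * indicator {x<..} y \<partial>lborel)"
    by (simp add: emeasure_density)
  also have "\<dots> = (\<integral>\<^sup>+y. ennreal (q y) * indicator {x..} y \<partial>lborel)"
    by (rule nn_integral_cong_AE)
       (use AE_lborel_singleton[of x] in eventually_elim, auto split: split_indicator)
  also have "\<dots> = ennreal (1 - cdf \<nu> x)"
    by (rule nn_integral_FTC_atLeast)
       (use cdf_deriv cdf_lim_at_top_prob q_pos in \<open>auto simp: q_def[symmetric] less_imp_le\<close>)
  also have "1 - cdf \<nu> x = measure \<nu> {x<..}"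
  proof -
    have "{x<..} = space \<nu> - {..x}" by auto
    then show ?thesis unfolding cdf_def by (simp only:) (subst prob_compl, auto)
  qed
  finally show "emeasure \<nu> {x<..} = emeasure (density lborel (\<lambda>x. ennreal (q x))) {x<..}"
    by (simp add: emeasure_eq_measure)
qed auto

text \<open>\<open>b (cdf \<nu> x)\<close> tends to \<open>b 0 > 0\<close> on the left and to
  \<open>b 1 < 0\<close> on the right. The slope is written \<open>2 * \<delta>\<close> because one
  half will pay for the weight \<open>exp (\<delta> * \<bar>x\<bar>)\<close> and the other for
  integrability.\<close>

lemma tail_slope:
  obtains \<delta> x0 x1 where "\<delta> > 0" "x0 \<le> 0" "0 \<le> x1"
    "\<And>x. x \<le> x0 \<Longrightarrow> 2 * \<delta> \<le> c * b (cdf \<nu> x)" "\<And>x. x1 \<le> x \<Longrightarrow> c * b (cdf \<nu> x) \<le> - 2 * \<delta>"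
proof -
  define m where "m = min (b 0) (- b 1) / 2"
  have m: "m > 0" "m < b 0" "b 1 < - m" using b_0 b_1 by (auto simp: m_def min_def)
  have cl: "clamp01 0 = 0" "clamp01 1 = 1" by (auto simp: clamp01_def)
  have "((\<lambda>x. b (clamp01 (cdf \<nu> x))) \<longlongrightarrow> b (clamp01 0)) at_bot"
    "((\<lambda>x. b (clamp01 (cdf \<nu> x))) \<longlongrightarrow> b (clamp01 1)) at_top"
    by (rule continuous_on_tendsto_compose[OF b_clamp01_cont];
        auto intro: cdf_lim_at_bot cdf_lim_at_top_prob)+
  then have "((\<lambda>x. b (cdf \<nu> x)) \<longlongrightarrow> b 0) at_bot" "((\<lambda>x. b (cdf \<nu> x)) \<longlongrightarrow> b 1) at_top"
    by (simp_all add: cl clamp01_cdf[OF is_distribution])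
  from order_tendstoD(1)[OF this(1) m(2)] order_tendstoD(2)[OF this(2) m(3)]
  obtain y0 y1 where y: "\<And>x. x \<le> y0 \<Longrightarrow> m < b (cdf \<nu> x)" "\<And>x. y1 \<le> x \<Longrightarrow> b (cdf \<nu> x) < - m"
    unfolding eventually_at_bot_linorder eventually_at_top_linorder by auto
  show ?thesis
  proof (rule that[of "c * m / 2" "min 0 y0" "max 0 y1"])
    show "2 * (c * m / 2) \<le> c * b (cdf \<nu> x)" if "x \<le> min 0 y0" for x
      using y(1)[of x] that c_pos by simp
    show "c * b (cdf \<nu> x) \<le> - 2 * (c * m / 2)" if "max 0 y1 \<le> x" for x
    proof -
      have "c * b (cdf \<nu> x) \<le> c * - m" using y(2)[of x] that c_pos by (intro mult_left_mono) auto
      then show ?thesis by simp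
    qed
  qed (use m c_pos in auto)
qed

text \<open>\<open>L x + 2 * \<delta> * \<bar>x\<bar>\<close> is bounded above: beyond
  \<open>x0\<close> and \<open>x1\<close> the slope bound makes it monotone, and between them
  \<open>L\<close> is at most \<open>ln (c * K)\<close>.\<close>

lemma exponential_moment:
  obtains \<delta> where "\<delta> > 0" "integrable lborel (\<lambda>x. q x * exp (\<delta> * \<bar>x\<bar>))"
proof -
  obtain \<delta> x0 x1 where \<delta>: "\<delta> > 0" and x01: "x0 \<le> 0" "0 \<le> x1"
    and sl: "\<And>x. x \<le> x0 \<Longrightarrow> 2 * \<delta> \<le> c * b (cdf \<nu> x)" "\<And>x. x1 \<le> x \<Longrightarrow> c * b (cdf \<nu> x) \<le> - 2 * \<delta>"
    by (rule tail_slope) blast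
  \<comment> \<open>As \<open>x0 \<le> 0 \<le> x1\<close>, this \<open>r\<close> dominates
    \<open>- x0\<close>, \<open>x1\<close> and every \<open>\<bar>x\<bar>\<close> in between, so one
    constant serves all three cases.\<close>
  define r where "r = x1 - x0"
  have lower: "L x - 2 * \<delta> * x \<le> L x0 - 2 * \<delta> * x0" if "x \<le> x0" for x
  proof (rule DERIV_nonneg_imp_nondecreasing[OF that, where f="\<lambda>x. L x - 2 * \<delta> * x"])
    fix y assume "x \<le> y" "y \<le> x0"
    then show "\<exists>d. ((\<lambda>x. L x - 2 * \<delta> * x) has_real_derivative d) (at y) \<and> 0 \<le> d"
      using sl(1)[of y] by (intro exI[of _ "c * b (cdf \<nu> y) - 2 * \<delta>"])
        (auto intro!: derivative_eq_intros L_deriv)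
  qed
  have upper: "L x + 2 * \<delta> * x \<le> L x1 + 2 * \<delta> * x1" if "x1 \<le> x" for x
  proof (rule DERIV_nonpos_imp_nonincreasing[OF that, where f="\<lambda>x. L x + 2 * \<delta> * x"])
    fix y assume "x1 \<le> y" "y \<le> x"
    then show "\<exists>d. ((\<lambda>x. L x + 2 * \<delta> * x) has_real_derivative d) (at y) \<and> d \<le> 0"
      using sl(2)[of y] by (intro exI[of _ "c * b (cdf \<nu> y) + 2 * \<delta>"])
        (auto intro!: derivative_eq_intros L_deriv)
  qed
  have ln_ck: "L x \<le> ln (c * K)" for x
    unfolding L_def using q_pos q_le by (intro ln_mono) (auto intro: less_le_trans)
  have bound: "q x * exp (\<delta> * \<bar>x\<bar>) \<le> exp (ln (c * K) + 2 * \<delta> * r) * exp (- \<delta> * \<bar>x\<bar>)" for x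
  proof -
    have "L x + 2 * \<delta> * \<bar>x\<bar> \<le> ln (c * K) + 2 * \<delta> * r"
    proof -
      consider "x \<le> x0" | "x0 < x" "x < x1" | "x1 \<le> x" by linarith
      then show ?thesis
      proof cases
        case 1
        have "0 \<le> \<delta> * x1" using x01 \<delta> by simp
        moreover have "\<bar>x\<bar> = - x" using 1 x01 by simp
        ultimately show ?thesis using lower[OF 1] ln_ck[of x0] by (simp add: r_def algebra_simps)
      next
        case 2
        then have "\<bar>x\<bar> \<le> r" using x01 by (simp add: r_def)
        then have "\<delta> * \<bar>x\<bar> \<le> \<delta> * r" using \<delta> by (intro mult_left_mono) auto
        then show ?thesis using ln_ck[of x] by simp
      next
        case 3
        have "0 \<le> - (\<delta> * x0)" using x01 \<delta> by (simp add: mult_nonneg_nonpos)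
        moreover have "\<bar>x\<bar> = x" using 3 x01 by simp
        ultimately show ?thesis using upper[OF 3] ln_ck[of x1] by (simp add: r_def algebra_simps)
      qed
    qed
    then have "L x + \<delta> * \<bar>x\<bar> \<le> ln (c * K) + 2 * \<delta> * r + - \<delta> * \<bar>x\<bar>" by simp
    then have "exp (L x + \<delta> * \<bar>x\<bar>) \<le> exp (ln (c * K) + 2 * \<delta> * r + - \<delta> * \<bar>x\<bar>)"
      by (simp only: exp_le_cancel_iff)
    then show ?thesis unfolding exp_add using q_pos[of x] by (simp add: L_def)
  qed
  have "integrable lborel (\<lambda>x. q x * exp (\<delta> * \<bar>x\<bar>))"
  proof (rule Bochner_Integration.integrable_bound)
    show "integrable lborel (\<lambda>x. exp (ln (c * K) + 2 * \<delta> * r) * exp (- \<delta> * \<bar>x\<bar>))"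
      by (intro integrable_mult_right integrable_exp_abs \<delta>)
    show "AE x in lborel. norm (q x * exp (\<delta> * \<bar>x\<bar>)) \<le> norm (exp (ln (c * K) + 2 * \<delta> * r) * exp (- \<delta> * \<bar>x\<bar>))"
      using bound q_pos by (intro AE_I2) (simp add: abs_mult less_imp_le)
  qed measurable
  with \<delta> show ?thesis by (rule that)
qed

end

section \<open>Integration by parts against a distribution function\<close>

text \<open>\<open>L x - L 0\<close> is the integral of \<open>l y * d x y\<close> over
  \<open>y\<close>, where \<open>d x\<close> is 1 on \<open>{0..<x}\<close> for positive
  \<open>x\<close> and -1 on \<open>{x..<0}\<close> for negative \<open>x\<close>. As
  \<open>\<bar>d x y\<bar>\<close> integrates to \<open>\<bar>x\<bar>\<close>, the first moment
  justifies Fubini; \<open>\<mu>\<close> may have atoms.\<close>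

lemma
  fixes \<mu> :: "real measure"
  assumes "real_distribution \<mu>" and int: "integrable \<mu> (\<lambda>x. x)"
    and L: "\<And>x. (L has_real_derivative l x) (at x)"
    and lm: "l \<in> borel_measurable borel" and lc: "continuous_on UNIV l" and lb: "\<And>x. \<bar>l x\<bar> \<le> C"
  shows integrable_antiderivative: "integrable \<mu> L"
    and integrable_cdf_weighted: "integrable lborel (\<lambda>y. l y * (indicator {0..} y - cdf \<mu> y))"
    and integral_antiderivative: "(\<integral>x. L x \<partial>\<mu>) = L 0 + (\<integral>y. l y * (indicator {0..} y - cdf \<mu> y) \<partial>lborel)"
proof -
  interpret real_distribution \<mu> by fact
  interpret P: pair_sigma_finite \<mu> lborel ..
  note lm[measurable]
  define d :: "real \<Rightarrow> real \<Rightarrow> real" where "d x y = indicator {0..} y - indicator {..y} x" for x y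
  have C: "C \<ge> 0" using lb[of 0] by simp
  have P1: "prob UNIV = 1" using prob_space by simp
  have "case_prod d = (\<lambda>p. (if 0 \<le> snd p then 1 else 0) - (if fst p \<le> snd p then 1 else 0))"
    by (auto simp: d_def split: split_indicator)
  also have "\<dots> \<in> borel_measurable (\<mu> \<Otimes>\<^sub>M lborel)" by measurable
  finally have dm[measurable]: "case_prod d \<in> borel_measurable (\<mu> \<Otimes>\<^sub>M lborel)" .
  have [measurable]: "d x \<in> borel_measurable borel" for x
  proof -
    have "d x = (\<lambda>y. indicator {0..} y - indicator {x..} y)"
      by (auto simp: d_def split: split_indicator)
    then show ?thesis by simp
  qed
  have dI: "integrable lborel (\<lambda>y. indicator {min 0 x..<max 0 x} y :: real)" for x :: real
    by (rule integrable_real_indicator) (auto simp: emeasure_lborel_Icc_eq)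
  have dn: "\<bar>d x y\<bar> = indicator {min 0 x..<max 0 x} y" for x y
    by (auto simp: d_def split: split_indicator)
  have dxI: "integrable lborel (\<lambda>y. d x y)" for x
  proof (rule Bochner_Integration.integrable_bound[OF dI[of x]])
    show "AE y in lborel. norm (d x y) \<le> norm (indicator {min 0 x..<max 0 x} y :: real)"
      by (rule AE_I2) (simp add: dn)
  qed simp
  have dPI: "integrable (\<mu> \<Otimes>\<^sub>M lborel) (case_prod d)"
  proof (rule P.Fubini_integrable[OF dm])
    have "(\<integral>y. norm (case_prod d (x, y)) \<partial>lborel) = \<bar>x\<bar>" for x
    proof -
      have "(\<integral>y. norm (case_prod d (x, y)) \<partial>lborel) = (\<integral>y. indicator {min 0 x..<max 0 x} y \<partial>lborel)"
        by (simp add: dn)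
      also have "\<dots> = \<bar>x\<bar>" by (simp add: min_def max_def)
      finally show ?thesis .
    qed
    then show "integrable \<mu> (\<lambda>x. \<integral>y. norm (case_prod d (x, y)) \<partial>lborel)" using int by simp
    show "AE x in \<mu>. integrable lborel (\<lambda>y. case_prod d (x, y))" using dxI by simp
  qed
  define f where "f x y = l y * d x y" for x y
  have fm[measurable]: "case_prod f \<in> borel_measurable (\<mu> \<Otimes>\<^sub>M lborel)"
    unfolding f_def split_beta' using dm by (simp add: split_beta')
  have fPI: "integrable (\<mu> \<Otimes>\<^sub>M lborel) (case_prod f)"
  proof (rule Bochner_Integration.integrable_bound[OF integrable_mult_right[OF dPI, of C] fm])
    show "AE p in \<mu> \<Otimes>\<^sub>M lborel. norm (case_prod f p) \<le> norm (C * case_prod d p)"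
      by (rule AE_I2) (use lb C in \<open>auto simp: f_def abs_mult intro!: mult_right_mono\<close>)
  qed
  have FTC: "(\<integral>y. indicator {u..v} y *\<^sub>R l y \<partial>lborel) = L v - L u" if "u \<le> v" for u v
    by (rule integral_FTC_Icc[OF that])
       (use L lc in \<open>auto intro: has_field_derivative_at_within continuous_on_subset
          simp: has_real_derivative_iff_has_vector_derivative[symmetric]\<close>)
  have fy: "(\<integral>y. f x y \<partial>lborel) = L x - L 0" for x
  proof (cases "0 \<le> x")
    case True
    have "(\<integral>y. f x y \<partial>lborel) = (\<integral>y. indicator {0..x} y *\<^sub>R l y \<partial>lborel)"
    proof (rule integral_cong_AE)
      show "AE y in lborel. f x y = indicator {0..x} y *\<^sub>R l y"
        using AE_lborel_singleton[of x] by eventually_elim (use True in \<open>auto simp: f_def d_def split: split_indicator\<close>)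
    qed (simp_all add: f_def)
    then show ?thesis using FTC[OF True] by simp
  next
    case False
    have "(\<integral>y. f x y \<partial>lborel) = (\<integral>y. - (indicator {x..0} y *\<^sub>R l y) \<partial>lborel)"
    proof (rule integral_cong_AE)
      show "AE y in lborel. f x y = - (indicator {x..0} y *\<^sub>R l y)"
        using AE_lborel_singleton[of 0] by eventually_elim (use False in \<open>auto simp: f_def d_def split: split_indicator\<close>)
    qed (simp_all add: f_def)
    then show ?thesis using FTC[of x 0] False by simp
  qed
  have fx: "(\<integral>x. f x y \<partial>\<mu>) = l y * (indicator {0..} y - cdf \<mu> y)" for y
  proof -
    have "(\<integral>x. d x y \<partial>\<mu>) = (\<integral>x. indicator {0..} y \<partial>\<mu>) - (\<integral>x. indicator {..y} x \<partial>\<mu>)"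
      unfolding d_def by (rule Bochner_Integration.integral_diff) (auto simp: emeasure_eq_measure)
    then show ?thesis using P1 by (simp add: f_def cdf_def)
  qed
  have "integrable \<mu> (\<lambda>x. L x - L 0)"
    using P.integrable_fst'[OF fPI] by (simp add: fy)
  from Bochner_Integration.integrable_add[OF this, of "\<lambda>_. L 0"] show LI: "integrable \<mu> L" by simp
  show "integrable lborel (\<lambda>y. l y * (indicator {0..} y - cdf \<mu> y))"
    using P.integrable_snd[OF fPI] by (simp add: fx)
  have "(\<integral>x. L x \<partial>\<mu>) - L 0 = (\<integral>x. L x - L 0 \<partial>\<mu>)" using LI P1 by simp
  also have "\<dots> = (\<integral>y. l y * (indicator {0..} y - cdf \<mu> y) \<partial>lborel)"
    using P.Fubini_integral[OF fPI] by (simp add: fx fy)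
  finally show "(\<integral>x. L x \<partial>\<mu>) = L 0 + (\<integral>y. l y * (indicator {0..} y - cdf \<mu> y) \<partial>lborel)" by simp
qed

section \<open>Entropies and translations\<close>

lemma ext_integral_eq_integral: "integrable M f \<Longrightarrow> ext_integral M f = ereal (\<integral>x. f x \<partial>M)"
proof -
  assume f: "integrable M f"
  then have fin: "(\<integral>\<^sup>+x. ennreal (f x) \<partial>M) \<noteq> \<infinity>" "(\<integral>\<^sup>+x. ennreal (- f x) \<partial>M) \<noteq> \<infinity>"
    by (auto simp: real_integrable_def)
  then obtain r s where "(\<integral>\<^sup>+x. ennreal (f x) \<partial>M) = ennreal r" "r \<ge> 0"
    "(\<integral>\<^sup>+x. ennreal (- f x) \<partial>M) = ennreal s" "s \<ge> 0"
    by (metis ennreal_cases infinity_ennreal_def)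
  then show "ext_integral M f = ereal (\<integral>x. f x \<partial>M)"
    using real_lebesgue_integral_def[OF f] by (simp add: ext_integral_def)
qed

lemma ext_integral_eq_infinity:
  assumes f: "f \<in> borel_measurable M" "\<not> integrable M f" and fin: "(\<integral>\<^sup>+x. ennreal (- f x) \<partial>M) < \<infinity>"
  shows "ext_integral M f = \<infinity>"
proof -
  have "(\<integral>\<^sup>+x. ennreal (f x) \<partial>M) = \<infinity>" using f fin by (auto simp: real_integrable_def)
  moreover obtain s where "(\<integral>\<^sup>+x. ennreal (- f x) \<partial>M) = ennreal s" "s \<ge> 0"
    using fin by (metis ennreal_cases infinity_ennreal_def less_irrefl)
  ultimately show ?thesis by (simp add: ext_integral_def)
qed

lemma ext_integral_cong_AE: "(AE x in M. f x = g x) \<Longrightarrow> ext_integral M f = ext_integral M g"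
  unfolding ext_integral_def
  by (intro arg_cong2[where f="(-)"] arg_cong[where f=enn2ereal] nn_integral_cong_AE) auto

lemma ext_integral_nonpos: "(\<And>x. f x \<le> 0) \<Longrightarrow> ext_integral M f \<le> 0"
proof -
  assume "\<And>x. f x \<le> 0"
  then have "ext_integral M f = - enn2ereal (\<integral>\<^sup>+x. ennreal (- f x) \<partial>M)"
    by (simp add: ext_integral_def ennreal_neg zero_ennreal.rep_eq)
  then show ?thesis by (simp add: enn2ereal_nonneg)
qed

lemma ext_integral_density:
  assumes [measurable]: "f \<in> borel_measurable M" "g \<in> borel_measurable M" and "\<And>x. 0 \<le> g x"
  shows "ext_integral (density M (\<lambda>x. ennreal (g x))) f = ext_integral M (\<lambda>x. g x * f x)"
proof -
  have "(\<integral>\<^sup>+x. ennreal (h x) \<partial>density M (\<lambda>x. ennreal (g x))) = (\<integral>\<^sup>+x. ennreal (g x * h x) \<partial>M)"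
    if [measurable]: "h \<in> borel_measurable M" for h
    using assms by (simp add: nn_integral_density ennreal_mult')
  from this[of f] this[of "\<lambda>x. - f x"] show ?thesis by (simp add: ext_integral_def)
qed

lemma ext_integral_lborel_shift:
  fixes y :: real
  assumes [measurable]: "f \<in> borel_measurable borel"
  shows "ext_integral lborel (\<lambda>x. f (x - y)) = ext_integral lborel f"
proof -
  have "(\<integral>\<^sup>+x. ennreal (h (x - y)) \<partial>lborel) = (\<integral>\<^sup>+x. ennreal (h x) \<partial>lborel)"
    if [measurable]: "h \<in> borel_measurable borel" for h :: "real \<Rightarrow> real"
    using nn_integral_real_affine[of "\<lambda>x. ennreal (h x)" 1 "- y"] by simp
  from this[of f] this[of "\<lambda>x. - f x"] show ?thesis by (simp add: ext_integral_def)
qed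

lemma ac_density_real:
  assumes "real_distribution \<mu>" and ac: "absolutely_continuous lborel \<mu>"
  obtains p where "p \<in> borel_measurable borel" "\<And>x. (0::real) \<le> p x" "\<mu> = density lborel (\<lambda>x. ennreal (p x))"
proof -
  interpret real_distribution \<mu> by fact
  have s: "sets \<mu> = sets lborel" by simp
  have "AE x in lborel. RN_deriv lborel \<mu> x \<noteq> \<infinity>"
    by (rule sigma_finite_measure.RN_deriv_finite[OF sigma_finite_lborel _ ac s]) unfold_locales
  then have "density lborel (\<lambda>x. ennreal (enn2real (RN_deriv lborel \<mu> x))) = density lborel (RN_deriv lborel \<mu>)"
    by (intro density_cong) (auto elim!: eventually_mono simp: less_top)
  also have "\<dots> = \<mu>" by (rule sigma_finite_measure.density_RN_deriv[OF sigma_finite_lborel ac s])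
  finally show ?thesis by (intro that[of "\<lambda>x. enn2real (RN_deriv lborel \<mu> x)"]) auto
qed

lemma real_distribution_density:
  assumes "real_distribution (density lborel (\<lambda>x. ennreal (p x)))"
    and [measurable]: "p \<in> borel_measurable borel" and p: "\<And>x. (0::real) \<le> p x"
  shows "integrable lborel p" "(\<integral>x. p x \<partial>lborel) = 1"
proof -
  have "emeasure (density lborel (\<lambda>x. ennreal (p x))) UNIV = 1"
    using prob_space.emeasure_space_1[of "density lborel (\<lambda>x. ennreal (p x))"] assms(1)
    by (simp add: real_distribution_def)
  then have *: "(\<integral>\<^sup>+x. ennreal (p x) \<partial>lborel) = 1" by (simp add: emeasure_density)
  then show "integrable lborel p" using p by (intro integrableI_nonneg) auto
  show "(\<integral>x. p x \<partial>lborel) = 1" by (subst integral_eq_nn_integral) (use p * in auto)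
qed

lemma boltzmann_entropy_density:
  assumes [measurable]: "p \<in> borel_measurable borel" and p: "\<And>x. (0::real) \<le> p x"
    and \<mu>: "\<mu> = density lborel (\<lambda>x. ennreal (p x))" and int: "integrable \<mu> (\<lambda>x. x)"
  shows "boltzmann_entropy \<mu> = ext_integral lborel (\<lambda>x. p x * ln (p x))"
proof -
  have ac: "absolutely_continuous lborel \<mu>"
    unfolding \<mu> by (rule absolutely_continuousI_density) simp
  have "AE x in lborel. ennreal (p x) = RN_deriv lborel \<mu> x"
    by (rule sigma_finite_measure.RN_deriv_unique[OF sigma_finite_lborel]) (simp_all add: \<mu>)
  then have "ext_integral lborel
             (\<lambda>x. enn2real (RN_deriv lborel \<mu> x) * ln (enn2real (RN_deriv lborel \<mu> x)))
      = ext_integral lborel (\<lambda>x. p x * ln (p x))"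
    by (intro ext_integral_cong_AE) (auto elim!: eventually_mono simp: p dest: sym)
  then show ?thesis using ac int by (simp add: boltzmann_entropy_def)
qed

lemma boltzmann_entropy_infinity:
  "\<not> (integrable \<mu> (\<lambda>x. x) \<and> absolutely_continuous lborel \<mu>) \<Longrightarrow> boltzmann_entropy \<mu> = \<infinity>"
  unfolding boltzmann_entropy_def by (rule if_not_P)

section \<open>Translation invariance\<close>

lemma real_distribution_translate:
  "real_distribution \<mu> \<Longrightarrow> real_distribution (translate y \<mu>)"
  unfolding translate_def real_distribution_def real_distribution_axioms_def
  by (auto intro!: prob_space.prob_space_distr)

lemma translate_0: "real_distribution \<mu> \<Longrightarrow> translate 0 \<mu> = \<mu>"
  unfolding translate_def real_distribution_def real_distribution_axioms_def by (simp add: distr_id2)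

lemma translate_translate:
  assumes "real_distribution \<mu>" shows "translate z (translate y \<mu>) = translate (y + z) \<mu>"
proof -
  interpret real_distribution \<mu> by fact
  show ?thesis unfolding translate_def by (subst distr_distr) (auto simp: comp_def add.assoc)
qed

lemma cdf_translate:
  assumes "real_distribution \<mu>" shows "cdf (translate y \<mu>) x = cdf \<mu> (x - y)"
proof -
  interpret real_distribution \<mu> by fact
  have "(\<lambda>x. x + y) -` {..x} = {..x - y}" by auto
  then show ?thesis by (simp add: cdf_def translate_def measure_distr)
qed

lemma integrable_translate:
  assumes "real_distribution \<mu>" and int: "integrable \<mu> (\<lambda>x. x)"
  shows "integrable (translate y \<mu>) (\<lambda>x. x)"
proof -
  interpret real_distribution \<mu> by fact
  show ?thesis unfolding translate_def
  proof (rule integrable_distr_eq[THEN iffD2])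
    show "integrable \<mu> (\<lambda>x. x + y)" using int by (rule Bochner_Integration.integrable_add) simp
  qed measurable
qed

lemma translate_density:
  assumes [measurable]: "p \<in> borel_measurable borel"
  shows "translate y (density lborel (\<lambda>x. ennreal (p x))) = density lborel (\<lambda>x. ennreal (p (x - y)))"
proof (rule measure_eqI)
  fix A assume "A \<in> sets (translate y (density lborel (\<lambda>x. ennreal (p x))))"
  then have [measurable]: "A \<in> sets borel" by (simp add: translate_def)
  have [measurable]: "(\<lambda>x. x + y) -` A \<in> sets borel"
    using measurable_sets[of "\<lambda>x. x + y" borel borel A] by simp
  have "emeasure (translate y (density lborel (\<lambda>x. ennreal (p x)))) A
      = (\<integral>\<^sup>+x. ennreal (p x) * indicator ((\<lambda>x. x + y) -` A) x \<partial>lborel)"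
    by (simp add: translate_def emeasure_distr emeasure_density)
  also have "\<dots> = (\<integral>\<^sup>+x. ennreal (p (x - y)) * indicator ((\<lambda>x. x + y) -` A) (x - y) \<partial>lborel)"
    using nn_integral_real_affine[of "\<lambda>x. ennreal (p x) * indicator ((\<lambda>x. x + y) -` A) x" 1 "- y"] by simp
  also have "\<dots> = emeasure (density lborel (\<lambda>x. ennreal (p (x - y)))) A"
    by (subst emeasure_density) (auto intro!: nn_integral_cong split: split_indicator)
  finally show "emeasure (translate y (density lborel (\<lambda>x. ennreal (p x)))) A
      = emeasure (density lborel (\<lambda>x. ennreal (p (x - y)))) A" .
qed (simp add: translate_def)

context
  fixes \<mu> :: "real measure" and y :: real
  assumes \<mu>: "real_distribution \<mu>"
begin

lemma boltzmann_entropy_translate_finite: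
  assumes "integrable \<mu> (\<lambda>x. x)" "absolutely_continuous lborel \<mu>"
  shows "absolutely_continuous lborel (translate y \<mu>)" "boltzmann_entropy (translate y \<mu>) = boltzmann_entropy \<mu>"
proof -
  obtain p where p[measurable]: "p \<in> borel_measurable borel" "\<And>x. (0::real) \<le> p x"
    and d: "\<mu> = density lborel (\<lambda>x. ennreal (p x))"
    using ac_density_real[OF \<mu> assms(2)] by blast
  have t: "translate y \<mu> = density lborel (\<lambda>x. ennreal (p (x - y)))"
    unfolding d by (rule translate_density) simp
  show "absolutely_continuous lborel (translate y \<mu>)"
    unfolding t by (rule absolutely_continuousI_density) simp
  have "boltzmann_entropy (translate y \<mu>) = ext_integral lborel (\<lambda>x. p (x - y) * ln (p (x - y)))"
    by (rule boltzmann_entropy_density[OF _ _ t integrable_translate[OF \<mu> assms(1)]]) (use p in auto)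
  also have "\<dots> = ext_integral lborel (\<lambda>x. p x * ln (p x))"
    by (rule ext_integral_lborel_shift) simp
  also have "\<dots> = boltzmann_entropy \<mu>"
    by (rule boltzmann_entropy_density[symmetric, OF _ _ d assms(1)]) (use p in auto)
  finally show "boltzmann_entropy (translate y \<mu>) = boltzmann_entropy \<mu>" .
qed

end

text \<open>In the infinite case the translate must fail the same conditions. If it satisfied them,
  translating back by \<open>- y\<close> would pass them on to \<open>\<mu>\<close>.\<close>

lemma boltzmann_entropy_translate:
  assumes \<mu>: "real_distribution \<mu>"
  shows "boltzmann_entropy (translate y \<mu>) = boltzmann_entropy \<mu>"
proof (cases "integrable \<mu> (\<lambda>x. x) \<and> absolutely_continuous lborel \<mu>")
  case True
  then show ?thesis using boltzmann_entropy_translate_finite(2)[OF \<mu>] by simp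
next
  case False
  have t: "real_distribution (translate y \<mu>)" using \<mu> by (rule real_distribution_translate)
  have inv: "translate (- y) (translate y \<mu>) = \<mu>" using \<mu> by (simp add: translate_translate translate_0)
  have "\<not> (integrable (translate y \<mu>) (\<lambda>x. x) \<and> absolutely_continuous lborel (translate y \<mu>))"
    using False integrable_translate[OF t, of "- y"]
      boltzmann_entropy_translate_finite(1)[OF t, of "- y"] unfolding inv by blast
  from boltzmann_entropy_infinity[OF this] boltzmann_entropy_infinity[OF False] show ?thesis by simp
qed

lemma (in rank_energy) energy_translate:
  assumes \<mu>: "real_distribution \<mu>"
  shows "energy B (translate y \<mu>) = energy B \<mu>"
  unfolding energy_def cdf_translate[OF \<mu>]
  by (rule ext_integral_lborel_shift) (rule B_cdf_measurable[OF \<mu>])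

lemma (in rank_energy) free_energy_translate:
  assumes \<mu>: "real_distribution \<mu>"
  shows "free_energy \<sigma> B (translate y \<mu>) = free_energy \<sigma> B \<mu>"
  using assms by (simp add: free_energy_def boltzmann_entropy_translate energy_translate)

lemma (in rank_energy) orbit_rate_eq:
  assumes \<mu>: "real_distribution \<mu>"
  shows "orbit_rate \<sigma> B (orbit_map \<mu>) = free_energy \<sigma> B \<mu> - min_free_energy \<sigma> B"
proof -
  have "(\<lambda>\<mu>. free_energy \<sigma> B \<mu> - min_free_energy \<sigma> B) ` orbit_map \<mu> = {free_energy \<sigma> B \<mu> - min_free_energy \<sigma> B}"
    unfolding orbit_map_def using free_energy_translate[OF \<mu>] by (auto simp: image_image)
  then show ?thesis by (simp add: orbit_rate_def)
qed

text \<open>\<open>B u\<close> is at most \<open>K * u\<close> and \<open>K * (1 - u)\<close>, hence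
  the integrand is at most \<open>K\<close> times the distance of \<open>cdf \<mu>\<close> to the
  distribution function of the unit mass at 0, which is integrable by the case \<open>l = 1\<close>
  of \<open>integrable_cdf_weighted\<close>.\<close>

lemma (in rank_energy) integrable_B_cdf:
  assumes \<mu>: "real_distribution \<mu>" and int: "integrable \<mu> (\<lambda>x. x)"
  shows "integrable lborel (\<lambda>x. B (cdf \<mu> x))"
proof (rule Bochner_Integration.integrable_bound)
  have "integrable lborel (\<lambda>y. 1 * (indicator {0..} y - cdf \<mu> y))"
    by (rule integrable_cdf_weighted[OF \<mu> int, where L="\<lambda>x. x" and C=1]) auto
  then show "integrable lborel (\<lambda>y. K * \<bar>indicator {0..} y - cdf \<mu> y\<bar>)" by simp
  show "AE x in lborel. norm (B (cdf \<mu> x)) \<le> norm (K * \<bar>indicator {0..} x - cdf \<mu> x\<bar>)"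
  proof (rule AE_I2)
    fix x
    show "norm (B (cdf \<mu> x)) \<le> norm (K * \<bar>indicator {0..} x - cdf \<mu> x\<bar>)"
      using B_le[OF cdf_unit[OF \<mu>], of x] B_nonneg[OF cdf_unit[OF \<mu>], of x] cdf_unit[OF \<mu>, of x] K_nonneg
      by (simp split: split_indicator)
  qed
qed (use B_cdf_measurable[OF \<mu>] in simp)

section \<open>Relative entropy with respect to the profile\<close>

text \<open>This is \<open>ln t \<le> t - 1\<close> at \<open>t = q / p\<close>. It controls the
  negative parts of both entropies and later gives the minimality of the free energy.\<close>

lemma relative_entropy_integrand_lower_bound:
  assumes "(0::real) \<le> p" "0 < q"
  shows "p - q \<le> p * (ln p - ln q)"
proof (cases "p = 0")
  case False
  then have p: "p > 0" using assms by simp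
  have "ln (q / p) \<le> q / p - 1" using p assms by (intro ln_le_minus_one) simp
  then have "p * (ln q - ln p) \<le> p * (q / p - 1)"
    using p assms by (intro mult_left_mono) (auto simp: ln_div)
  then show ?thesis using p by (simp add: algebra_simps)
qed (use assms in simp)

text \<open>The preceding bound with \<open>q * exp s\<close> in place of \<open>q\<close>: a
  pointwise form of the entropy inequality, by which exponential moments of \<open>q\<close> control
  moments of \<open>p\<close>.\<close>

lemma fenchel_exp:
  assumes "(0::real) \<le> p" "0 < q"
  shows "p * s \<le> p * (ln p - ln q) - p + q * exp s"
  using relative_entropy_integrand_lower_bound[of p "q * exp s"] assms
  by (simp add: ln_mult algebra_simps)

context stationary_profile
begin

text \<open>\<open>q\<close> is positive everywhere, so \<open>\<nu>\<close> has the null sets of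
  Lebesgue measure.\<close>

lemma absolutely_continuous_\<nu>_iff: "absolutely_continuous \<nu> \<mu> \<longleftrightarrow> absolutely_continuous lborel \<mu>"
proof -
  have "null_sets \<nu> = null_sets lborel"
  proof (intro set_eqI iffI)
    fix N :: "real set" assume "N \<in> null_sets \<nu>"
    then have N: "N \<in> sets lborel" "AE x in lborel. x \<in> N \<longrightarrow> ennreal (q x) = 0"
      by (subst (asm) \<nu>_density, subst (asm) null_sets_density_iff; simp)+
    from N(2) have "AE x in lborel. x \<notin> N" by eventually_elim (use q_pos in \<open>auto simp: ennreal_eq_0_iff not_le[symmetric]\<close>)
    then show "N \<in> null_sets lborel" using N(1) by (simp add: AE_iff_null_sets)
  next
    fix N :: "real set" assume "N \<in> null_sets lborel"
    then show "N \<in> null_sets \<nu>"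
      by (subst \<nu>_density, subst null_sets_density_iff) (auto dest: AE_not_in elim!: eventually_mono)
  qed
  then show ?thesis by (simp add: absolutely_continuous_def)
qed

lemma relative_entropy_density:
  assumes [measurable]: "p \<in> borel_measurable borel" and p: "\<And>x. (0::real) \<le> p x"
    and \<mu>: "\<mu> = density lborel (\<lambda>x. ennreal (p x))"
  shows "relative_entropy \<mu> \<nu> = ext_integral lborel (\<lambda>x. p x * (ln (p x) - L x))"
proof -
  have ac: "absolutely_continuous \<nu> \<mu>"
    unfolding absolutely_continuous_\<nu>_iff \<mu> by (rule absolutely_continuousI_density) simp
  define r where "r x = p x / q x" for x
  have [measurable]: "r \<in> borel_measurable borel" unfolding r_def by measurable
  have r: "0 \<le> r x" for x using p q_pos by (simp add: r_def less_imp_le)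
  have "density \<nu> (\<lambda>x. ennreal (r x)) = density lborel (\<lambda>x. ennreal (q x) * ennreal (r x))"
    by (subst \<nu>_density, subst density_density_eq) simp_all
  also have "\<dots> = \<mu>"
    unfolding \<mu> using q_pos p r by (intro density_cong) (auto simp: ennreal_mult'[symmetric] r_def less_imp_le less_imp_neq[THEN not_sym])
  finally have dr: "density \<nu> (\<lambda>x. ennreal (r x)) = \<mu>" .
  have "AE x in \<nu>. ennreal (r x) = RN_deriv \<nu> \<mu> x"
    by (rule RN_deriv_unique[OF _ dr]) simp
  then have "ext_integral \<nu> (\<lambda>x. enn2real (RN_deriv \<nu> \<mu> x) * ln (enn2real (RN_deriv \<nu> \<mu> x)))
      = ext_integral \<nu> (\<lambda>x. r x * ln (r x))"
    by (intro ext_integral_cong_AE) (auto elim!: eventually_mono simp: r dest: sym)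
  also have "\<dots> = ext_integral lborel (\<lambda>x. q x * (r x * ln (r x)))"
    by (subst \<nu>_density, rule ext_integral_density) (use q_pos in \<open>auto simp: less_imp_le\<close>)
  also have "(\<lambda>x. q x * (r x * ln (r x))) = (\<lambda>x. p x * (ln (p x) - L x))"
  proof
    fix x
    show "q x * (r x * ln (r x)) = p x * (ln (p x) - L x)"
      using q_pos[of x] p[of x] by (cases "p x = 0") (auto simp: r_def L_def ln_div)
  qed
  finally show ?thesis using ac by (simp add: relative_entropy_def)
qed

lemma relative_entropy_not_ac:
  "\<not> absolutely_continuous lborel \<mu> \<Longrightarrow> relative_entropy \<mu> \<nu> = \<infinity>"
  by (simp add: relative_entropy_def absolutely_continuous_\<nu>_iff)

lemma integrable_q: "integrable lborel q" and integral_q: "(\<integral>x. q x \<partial>lborel) = 1"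
  using real_distribution_density[OF subst[where P=real_distribution, OF \<nu>_density is_distribution] q_measurable] q_pos
  by (auto simp: less_imp_le)

text \<open>The integrand is at least \<open>p - q\<close>, hence at least \<open>- q\<close>, and
  \<open>q\<close> is integrable. Thus \<open>ext_integral\<close> never meets a difference of two
  infinities here.\<close>

lemma relative_entropy_negative_part:
  assumes "\<And>x. (0::real) \<le> p x"
  shows "(\<integral>\<^sup>+x. ennreal (- (p x * (ln (p x) - L x))) \<partial>lborel) < \<infinity>"
proof -
  have "- (p x * (ln (p x) - L x)) \<le> q x" for x
    using relative_entropy_integrand_lower_bound[OF assms q_pos, of x x] assms[of x] by (simp add: L_def)
  then have "(\<integral>\<^sup>+x. ennreal (- (p x * (ln (p x) - L x))) \<partial>lborel) \<le> (\<integral>\<^sup>+x. ennreal (q x) \<partial>lborel)"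
    by (intro nn_integral_mono ennreal_leI)
  also have "\<dots> < \<infinity>" using integrable_q by (auto simp: real_integrable_def less_top)
  finally show ?thesis .
qed

text \<open>Were the relative entropy integrand integrable, \<open>fenchel_exp\<close> with
  \<open>s = \<delta> * \<bar>x\<bar>\<close> would bound
  \<open>\<delta> * \<bar>x\<bar> * p x\<close> by it plus
  \<open>q x * exp (\<delta> * \<bar>x\<bar>)\<close>, which is integrable too, and
  \<open>\<mu>\<close> would have a first moment.\<close>

lemma relative_entropy_infinite_moment:
  assumes \<mu>: "real_distribution \<mu>" and inf: "\<not> integrable \<mu> (\<lambda>x. x)"
  shows "relative_entropy \<mu> \<nu> = \<infinity>"
proof (cases "absolutely_continuous lborel \<mu>")
  case True
  obtain p where p[measurable]: "p \<in> borel_measurable borel" and p0: "\<And>x. (0::real) \<le> p x"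
    and d: "\<mu> = density lborel (\<lambda>x. ennreal (p x))"
    using ac_density_real[OF \<mu> True] by blast
  obtain \<delta> where \<delta>: "\<delta> > 0" and e: "integrable lborel (\<lambda>x. q x * exp (\<delta> * \<bar>x\<bar>))"
    by (rule exponential_moment) blast
  have "\<not> integrable lborel (\<lambda>x. p x * (ln (p x) - L x))"
  proof
    assume I: "integrable lborel (\<lambda>x. p x * (ln (p x) - L x))"
    have "integrable lborel (\<lambda>x. p x * x)"
    proof (rule Bochner_Integration.integrable_bound)
      show "integrable lborel (\<lambda>x. (p x * (ln (p x) - L x) + q x * exp (\<delta> * \<bar>x\<bar>)) / \<delta>)"
        using I e by simp
      show "AE x in lborel. norm (p x * x) \<le> norm ((p x * (ln (p x) - L x) + q x * exp (\<delta> * \<bar>x\<bar>)) / \<delta>)"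
      proof (rule AE_I2)
        fix x
        have "p x * (\<delta> * \<bar>x\<bar>) \<le> p x * (ln (p x) - L x) + q x * exp (\<delta> * \<bar>x\<bar>)"
          using fenchel_exp[OF p0 q_pos, of x "\<delta> * \<bar>x\<bar>" x] p0[of x] by (simp add: L_def)
        then have "p x * \<bar>x\<bar> \<le> (p x * (ln (p x) - L x) + q x * exp (\<delta> * \<bar>x\<bar>)) / \<delta>"
          using \<delta> by (simp add: le_divide_eq mult_ac)
        then show "norm (p x * x) \<le> norm ((p x * (ln (p x) - L x) + q x * exp (\<delta> * \<bar>x\<bar>)) / \<delta>)"
          using p0[of x] by (simp add: abs_mult del: abs_divide)
      qed
    qed simp
    then have "integrable \<mu> (\<lambda>x. x)"
      unfolding d by (subst integrable_density) (use p0 in auto)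
    with inf show False by simp
  qed
  then have "ext_integral lborel (\<lambda>x. p x * (ln (p x) - L x)) = \<infinity>"
    by (intro ext_integral_eq_infinity relative_entropy_negative_part p0) simp_all
  then show ?thesis using relative_entropy_density[OF p p0 d] by simp
qed (rule relative_entropy_not_ac)

lemma drift_continuous: "continuous_on UNIV (\<lambda>x. c * b (cdf \<nu> x))"
  by (intro continuous_intros continuous_on_compose2[OF b_cont cdf_cont])
     (use cdf_unit[OF is_distribution] in auto)

lemma drift_measurable: "(\<lambda>x. c * b (cdf \<nu> x)) \<in> borel_measurable borel"
  using drift_continuous by (rule borel_measurable_continuous_onI)

context
  fixes \<mu> :: "real measure"
  assumes \<mu>: "real_distribution \<mu>" and int: "integrable \<mu> (\<lambda>x. x)"
begin

lemma integrable_L: "integrable \<mu> L"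
  by (rule integrable_antiderivative[OF \<mu> int L_deriv drift_measurable drift_continuous drift_bound])

text \<open>Both integrals of \<open>L\<close> come from \<open>integral_antiderivative\<close> with
  the same \<open>l\<close>, so \<open>L 0\<close> and the indicator cancel. The minus sign arises
  because \<open>cdf\<close> enters that formula negatively.\<close>

lemma L_integral_difference:
  shows "integrable lborel (\<lambda>x. b (cdf \<nu> x) * (cdf \<mu> x - cdf \<nu> x))"
    and "(\<integral>x. L x \<partial>\<mu>) - (\<integral>x. L x \<partial>\<nu>) = - c * (\<integral>x. b (cdf \<nu> x) * (cdf \<mu> x - cdf \<nu> x) \<partial>lborel)"
proof -
  note W\<mu> = integrable_cdf_weighted[OF \<mu> int L_deriv drift_measurable drift_continuous drift_bound]
    integral_antiderivative[OF \<mu> int L_deriv drift_measurable drift_continuous drift_bound]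
  note W\<nu> = integrable_cdf_weighted[OF is_distribution first_moment L_deriv drift_measurable drift_continuous drift_bound]
    integral_antiderivative[OF is_distribution first_moment L_deriv drift_measurable drift_continuous drift_bound]
  have eq: "c * b (cdf \<nu> x) * (indicator {0..} x - cdf \<nu> x) - c * b (cdf \<nu> x) * (indicator {0..} x - cdf \<mu> x)
      = c * (b (cdf \<nu> x) * (cdf \<mu> x - cdf \<nu> x))" for x by (simp add: algebra_simps)
  have I: "integrable lborel (\<lambda>x. c * (b (cdf \<nu> x) * (cdf \<mu> x - cdf \<nu> x)))"
    using Bochner_Integration.integrable_diff[OF W\<nu>(1) W\<mu>(1)] by (simp only: eq)
  then show "integrable lborel (\<lambda>x. b (cdf \<nu> x) * (cdf \<mu> x - cdf \<nu> x))" using c_pos by simp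
  have "(\<integral>x. L x \<partial>\<nu>) - (\<integral>x. L x \<partial>\<mu>) = (\<integral>x. c * (b (cdf \<nu> x) * (cdf \<mu> x - cdf \<nu> x)) \<partial>lborel)"
    unfolding W\<mu>(2) W\<nu>(2) using Bochner_Integration.integral_diff[OF W\<nu>(1) W\<mu>(1)] by (simp only: eq)
  then show "(\<integral>x. L x \<partial>\<mu>) - (\<integral>x. L x \<partial>\<nu>) = - c * (\<integral>x. b (cdf \<nu> x) * (cdf \<mu> x - cdf \<nu> x) \<partial>lborel)"
    by simp
qed

text \<open>Under a first moment \<open>L\<close> is integrable against \<open>\<mu>\<close>, so
  passing from Lebesgue measure to \<open>\<nu>\<close> as reference changes the entropy by a finite
  amount. The lower bound relative to \<open>q\<close> therefore also controls
  \<open>p * ln p\<close>.\<close>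

lemma
  assumes [measurable]: "p \<in> borel_measurable borel" and p0: "\<And>x. 0 \<le> p x"
    and d: "\<mu> = density lborel (\<lambda>x. ennreal (p x))"
  shows integrable_density_L: "integrable lborel (\<lambda>x. p x * L x)"
    and integral_density_L: "(\<integral>x. p x * L x \<partial>lborel) = (\<integral>x. L x \<partial>\<mu>)"
    and boltzmann_negative_part: "(\<integral>\<^sup>+x. ennreal (- (p x * ln (p x))) \<partial>lborel) < \<infinity>"
    and integrable_entropy_iff:
      "integrable lborel (\<lambda>x. p x * (ln (p x) - L x)) \<longleftrightarrow> integrable lborel (\<lambda>x. p x * ln (p x))"
proof -
  show pL: "integrable lborel (\<lambda>x. p x * L x)"
    using integrable_L unfolding d by (subst (asm) integrable_density) (use p0 in auto)
  show "(\<integral>x. p x * L x \<partial>lborel) = (\<integral>x. L x \<partial>\<mu>)"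
    unfolding d by (subst integral_density) (use p0 in auto)
  have I: "integrable lborel (\<lambda>x. q x - p x * L x)" using integrable_q pL by simp
  have "- (p x * ln (p x)) \<le> q x - p x * L x" for x
    using relative_entropy_integrand_lower_bound[OF p0 q_pos, of x x] p0[of x]
    by (simp add: L_def algebra_simps)
  then have "(\<integral>\<^sup>+x. ennreal (- (p x * ln (p x))) \<partial>lborel) \<le> (\<integral>\<^sup>+x. ennreal (q x - p x * L x) \<partial>lborel)"
    by (intro nn_integral_mono ennreal_leI)
  also have "\<dots> < \<infinity>" using I by (auto simp: real_integrable_def less_top)
  finally show "(\<integral>\<^sup>+x. ennreal (- (p x * ln (p x))) \<partial>lborel) < \<infinity>" .
  show "integrable lborel (\<lambda>x. p x * (ln (p x) - L x)) \<longleftrightarrow> integrable lborel (\<lambda>x. p x * ln (p x))"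
  proof
    assume "integrable lborel (\<lambda>x. p x * (ln (p x) - L x))"
    from Bochner_Integration.integrable_add[OF this pL]
    show "integrable lborel (\<lambda>x. p x * ln (p x))" by (simp add: right_diff_distrib)
  next
    assume "integrable lborel (\<lambda>x. p x * ln (p x))"
    from Bochner_Integration.integrable_diff[OF this pL]
    show "integrable lborel (\<lambda>x. p x * (ln (p x) - L x))" by (simp add: right_diff_distrib)
  qed
qed

end

end

section \<open>The free energy\<close>

context stationary_profile
begin

lemma free_energy_density:
  assumes \<mu>: "real_distribution \<mu>" and int: "integrable \<mu> (\<lambda>x. x)" and c: "c = 2 / \<sigma>\<^sup>2"
    and p[measurable]: "p \<in> borel_measurable borel" and p0: "\<And>x. 0 \<le> p x"
    and d: "\<mu> = density lborel (\<lambda>x. ennreal (p x))"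
  shows "free_energy \<sigma> B \<mu> =
    (if integrable lborel (\<lambda>x. p x * ln (p x))
     then ereal ((\<integral>x. p x * ln (p x) \<partial>lborel) + c * (\<integral>x. B (cdf \<mu> x) \<partial>lborel)) else \<infinity>)"
proof -
  have "energy B \<mu> = ereal (\<integral>x. B (cdf \<mu> x) \<partial>lborel)"
    unfolding energy_def by (rule ext_integral_eq_integral[OF integrable_B_cdf[OF \<mu> int]])
  moreover have "boltzmann_entropy \<mu> = (if integrable lborel (\<lambda>x. p x * ln (p x))
      then ereal (\<integral>x. p x * ln (p x) \<partial>lborel) else \<infinity>)"
    unfolding boltzmann_entropy_density[OF p p0 d int]
    using ext_integral_eq_integral ext_integral_eq_infinity[OF _ _ boltzmann_negative_part[OF \<mu> int p p0 d]]
    by auto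
  ultimately show ?thesis by (simp add: free_energy_def c)
qed

lemma free_energy_not_ac:
  assumes "\<not> (integrable \<mu> (\<lambda>x. x) \<and> absolutely_continuous lborel \<mu>)"
  shows "free_energy \<sigma> B \<mu> = \<infinity>"
  unfolding free_energy_def boltzmann_entropy_infinity[OF assms] by simp

text \<open>The value is finite, which is what makes the subtraction of the minimum harmless in
  \<open>ereal\<close>.\<close>

lemma free_energy_profile:
  assumes "c = 2 / \<sigma>\<^sup>2"
  shows "free_energy \<sigma> B \<nu> = ereal ((\<integral>x. L x \<partial>\<nu>) + c * (\<integral>x. B (cdf \<nu> x) \<partial>lborel))"
proof -
  have q0: "0 \<le> q x" for x using q_pos by (rule less_imp_le)
  have "integrable lborel (\<lambda>x. q x * ln (q x))" "(\<integral>x. q x * ln (q x) \<partial>lborel) = (\<integral>x. L x \<partial>\<nu>)"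
    using integrable_density_L[OF is_distribution first_moment q_measurable q0 \<nu>_density]
      integral_density_L[OF is_distribution first_moment q_measurable q0 \<nu>_density]
    by (simp_all add: L_def)
  then show ?thesis
    using free_energy_density[OF is_distribution first_moment assms q_measurable q0 \<nu>_density] by simp
qed

text \<open>The reference density depends on the competitor: \<open>p\<close> is compared with
  \<open>c * B (cdf \<mu> x)\<close>, and this becomes a bound independent of \<open>\<mu>\<close>
  because the logarithm of the reference is a function of \<open>cdf \<mu>\<close> alone.\<close>

lemma free_energy_minimal:
  assumes \<mu>: "real_distribution \<mu>" and c: "c = 2 / \<sigma>\<^sup>2"
  shows "free_energy \<sigma> B \<nu> \<le> free_energy \<sigma> B \<mu>"
proof (cases "integrable \<mu> (\<lambda>x. x) \<and> absolutely_continuous lborel \<mu>")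
  case True
  then have int: "integrable \<mu> (\<lambda>x. x)" and ac: "absolutely_continuous lborel \<mu>" by auto
  obtain p where p[measurable]: "p \<in> borel_measurable borel" and p0: "\<And>x. (0::real) \<le> p x"
    and d: "\<mu> = density lborel (\<lambda>x. ennreal (p x))"
    using ac_density_real[OF \<mu> ac] by blast
  interpret \<mu>: real_distribution \<mu> by fact
  note fe = free_energy_density[OF \<mu> int c p p0 d]
  show ?thesis
  proof (cases "integrable lborel (\<lambda>x. p x * ln (p x))")
    case False
    then show ?thesis using fe by simp
  next
    case I: True
    have "measure \<mu> {x} = 0" for x
    proof -
      have "{x} \<in> null_sets lborel" by (rule null_setsI) auto
      then have "{x} \<in> null_sets \<mu>" using ac by (auto simp: absolutely_continuous_def)
      then show ?thesis by (simp add: null_sets_def measure_def)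
    qed
    then have cont: "continuous_on UNIV (cdf \<mu>)"
      by (intro continuous_at_imp_continuous_on) (simp add: \<mu>.isCont_cdf)
    have [measurable]: "cdf \<mu> \<in> borel_measurable borel" by (rule cdf_measurable[OF \<mu>])
    define l where "l u = ln (c * B (clamp01 u))" for u
    have lm[measurable]: "l \<in> borel_measurable borel" unfolding l_def by measurable
    have lL: "l (cdf \<nu> x) = L x" for x by (simp add: l_def L_def q_def clamp01_cdf is_distribution)
    \<comment> \<open>The singularities of \<open>l\<close> at 0 and 1 are integrable because
      \<open>L\<close> is integrable under \<open>\<nu>\<close>; the uniform law carries this over
      to \<open>\<mu>\<close>.\<close>
    have "integrable \<nu> (\<lambda>x. l (cdf \<nu> x))" unfolding lL by (rule integrable_L[OF is_distribution first_moment])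
    then have lI: "integrable \<mu> (\<lambda>x. l (cdf \<mu> x))"
      unfolding integrable_compose_cdf[OF cdf_cont lm] \<mu>.integrable_compose_cdf[OF cont lm] .
    have li: "(\<integral>x. l (cdf \<mu> x) \<partial>\<mu>) = (\<integral>x. L x \<partial>\<nu>)"
      using trans[OF \<mu>.integral_compose_cdf[OF cont lm] integral_compose_cdf[OF cdf_cont lm, symmetric]]
      by (simp only: lL)
    have tr: "integrable \<mu> f \<longleftrightarrow> integrable lborel (\<lambda>x. p x * f x)"
      "(\<integral>x. f x \<partial>\<mu>) = (\<integral>x. p x * f x \<partial>lborel)"
      if [measurable]: "f \<in> borel_measurable borel" for f
      unfolding d by (subst integrable_density integral_density; use p0 in simp)+
    have lm: "(\<lambda>x. l (cdf \<mu> x)) \<in> borel_measurable borel" by measurable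
    have plI: "integrable lborel (\<lambda>x. p x * l (cdf \<mu> x))" using lI unfolding tr(1)[OF lm] .
    have pli: "(\<integral>x. p x * l (cdf \<mu> x) \<partial>lborel) = (\<integral>x. l (cdf \<mu> x) \<partial>\<mu>)" by (rule tr(2)[OF lm, symmetric])
    have pI: "integrable lborel p" "(\<integral>x. p x \<partial>lborel) = 1"
      using real_distribution_density[OF \<mu>[unfolded d] p p0] by auto
    \<comment> \<open>This is the total mass of \<open>q\<close>. On the side of the competitor, the
      integral of \<open>p\<close> in the integrated inequality supplies the same 1.\<close>
    have qi: "c * (\<integral>x. B (cdf \<nu> x) \<partial>lborel) = 1"
      using integral_q by (simp add: q_def)
    \<comment> \<open>The uniform law does not charge 0 and 1, so the reference
      \<open>c * B (cdf \<mu> x)\<close> is positive at almost every point where \<open>p\<close>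
      is; elsewhere the inequality reduces to \<open>B \<ge> 0\<close>.\<close>
    have "AE u in distr \<mu> borel (cdf \<mu>). 0 < u \<and> u < 1"
      unfolding \<mu>.distr_cdf_uniform[OF cont]
      using AE_lborel_singleton[of 0] AE_lborel_singleton[of 1]
      by (subst AE_density) (auto elim!: eventually_elim2 split: split_indicator)
    then have "AE x in \<mu>. 0 < cdf \<mu> x \<and> cdf \<mu> x < 1" by (subst (asm) AE_distr_iff) auto
    then have ae: "AE x in lborel. 0 < p x \<longrightarrow> 0 < cdf \<mu> x \<and> cdf \<mu> x < 1"
      unfolding d by (subst (asm) AE_density) (auto simp: d[symmetric])
    have "(\<integral>x. p x * l (cdf \<mu> x) + p x \<partial>lborel) \<le> (\<integral>x. p x * ln (p x) + c * B (cdf \<mu> x) \<partial>lborel)"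
    proof (rule integral_mono_AE)
      show "AE x in lborel. p x * l (cdf \<mu> x) + p x \<le> p x * ln (p x) + c * B (cdf \<mu> x)"
        using ae
      proof eventually_elim
        case (elim x)
        show ?case
        proof (cases "p x = 0")
          case True
          then show ?thesis using B_nonneg[OF cdf_unit[OF \<mu>]] c_pos by simp
        next
          case False
          then have "p x > 0" using p0[of x] by simp
          with elim have "c * B (cdf \<mu> x) > 0" using B_pos[of "cdf \<mu> x"] c_pos by simp
          from relative_entropy_integrand_lower_bound[OF p0 this, of x]
          show ?thesis by (simp add: l_def clamp01_cdf[OF \<mu>] algebra_simps)
        qed
      qed
    qed (use I plI pI integrable_B_cdf[OF \<mu> int] in auto)
    then have "(\<integral>x. L x \<partial>\<nu>) + 1 \<le> (\<integral>x. p x * ln (p x) \<partial>lborel) + c * (\<integral>x. B (cdf \<mu> x) \<partial>lborel)"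
      using I plI pI integrable_B_cdf[OF \<mu> int] by (simp add: li pli)
    then show ?thesis unfolding free_energy_profile[OF c] fe qi using I by simp
  qed
next
  case False
  then have "free_energy \<sigma> B \<mu> = \<infinity>" by (rule free_energy_not_ac)
  then show ?thesis by simp
qed

lemma min_free_energy_eq:
  assumes "c = 2 / \<sigma>\<^sup>2"
  shows "min_free_energy \<sigma> B = free_energy \<sigma> B \<nu>"
  unfolding min_free_energy_def
proof (rule antisym)
  show "(INF \<mu>\<in>borel_probs. free_energy \<sigma> B \<mu>) \<le> free_energy \<sigma> B \<nu>"
    by (rule INF_lower) (simp add: borel_probs_def is_distribution)
  show "free_energy \<sigma> B \<nu> \<le> (INF \<mu>\<in>borel_probs. free_energy \<sigma> B \<mu>)"
    by (rule INF_greatest) (simp add: borel_probs_def free_energy_minimal assms)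
qed

text \<open>The relative entropy uses the integral of \<open>L\<close> against \<open>\<mu>\<close>,
  the free energy of the profile that against \<open>\<nu>\<close>. Their difference is, by
  \<open>L_integral_difference\<close>, the part of \<open>Gamma_B\<close> linear in
  \<open>cdf \<mu> - cdf \<nu>\<close>; the energies supply the rest.\<close>

lemma free_energy_decomposition:
  assumes \<mu>: "real_distribution \<mu>" and c: "c = 2 / \<sigma>\<^sup>2"
  shows "free_energy \<sigma> B \<mu> - free_energy \<sigma> B \<nu> =
    relative_entropy \<mu> \<nu> + ereal c * ext_integral lborel (\<lambda>x. Gamma_B B b (cdf \<mu> x) (cdf \<nu> x))"
proof (cases "integrable \<mu> (\<lambda>x. x) \<and> absolutely_continuous lborel \<mu>")
  case False
  then consider "\<not> integrable \<mu> (\<lambda>x. x)" | "\<not> absolutely_continuous lborel \<mu>" by metis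
  then have "relative_entropy \<mu> \<nu> = \<infinity>"
    by cases (rule relative_entropy_infinite_moment[OF \<mu>] relative_entropy_not_ac; assumption)+
  \<comment> \<open>Both sides are infinite: a finite value is subtracted on the left, and on the
    right an infinite first summand prevails even over \<open>- \<infinity>\<close>.\<close>
  then show ?thesis
    using free_energy_not_ac[OF False] by (simp add: free_energy_profile[OF c])
next
  case True
  then have int: "integrable \<mu> (\<lambda>x. x)" and ac: "absolutely_continuous lborel \<mu>" by auto
  obtain p where p[measurable]: "p \<in> borel_measurable borel" and p0: "\<And>x. (0::real) \<le> p x"
    and d: "\<mu> = density lborel (\<lambda>x. ennreal (p x))"
    using ac_density_real[OF \<mu> ac] by blast
  note fe = free_energy_density[OF \<mu> int c p p0 d]
  note BI = integrable_B_cdf[OF \<mu> int] integrable_B_cdf[OF is_distribution first_moment]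
  note LD = L_integral_difference[OF \<mu> int]
  note pL = integrable_density_L[OF \<mu> int p p0 d] integral_density_L[OF \<mu> int p p0 d]
  have G: "Gamma_B B b (cdf \<mu> x) (cdf \<nu> x)
      = B (cdf \<mu> x) - B (cdf \<nu> x) - b (cdf \<nu> x) * (cdf \<mu> x - cdf \<nu> x)" for x
    by (simp add: Gamma_B_def)
  have Ge: "ext_integral lborel (\<lambda>x. Gamma_B B b (cdf \<mu> x) (cdf \<nu> x))
      = ereal ((\<integral>x. B (cdf \<mu> x) \<partial>lborel) - (\<integral>x. B (cdf \<nu> x) \<partial>lborel)
          - (\<integral>x. b (cdf \<nu> x) * (cdf \<mu> x - cdf \<nu> x) \<partial>lborel))"
    unfolding G by (subst ext_integral_eq_integral) (use BI LD(1) in auto)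
  show ?thesis
  proof (cases "integrable lborel (\<lambda>x. p x * ln (p x))")
    case I: True
    then have J: "integrable lborel (\<lambda>x. p x * (ln (p x) - L x))"
      using integrable_entropy_iff[OF \<mu> int p p0 d] by simp
    have "(\<integral>x. p x * (ln (p x) - L x) \<partial>lborel) = (\<integral>x. p x * ln (p x) \<partial>lborel) - (\<integral>x. L x \<partial>\<mu>)"
      using Bochner_Integration.integral_diff[OF I pL(1)] by (simp add: right_diff_distrib pL(2))
    then have "relative_entropy \<mu> \<nu> = ereal ((\<integral>x. p x * ln (p x) \<partial>lborel) - (\<integral>x. L x \<partial>\<mu>))"
      using relative_entropy_density[OF p p0 d] ext_integral_eq_integral[OF J] by simp
    then show ?thesis
      using I LD(2) by (simp add: fe free_energy_profile[OF c] Ge algebra_simps)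
  next
    case False
    then have "\<not> integrable lborel (\<lambda>x. p x * (ln (p x) - L x))"
      using integrable_entropy_iff[OF \<mu> int p p0 d] by simp
    then have "relative_entropy \<mu> \<nu> = \<infinity>"
      unfolding relative_entropy_density[OF p p0 d]
      by (intro ext_integral_eq_infinity relative_entropy_negative_part p0) simp_all
    then show ?thesis using False by (simp add: fe free_energy_profile[OF c])
  qed
qed

text \<open>A concave function lies below its tangents, and \<open>cdf \<nu> x\<close> is an
  interior point of the unit interval, where the tangent inequality is available.\<close>

lemma Gamma_nonpos:
  assumes "concave_on {0..1} B" and u: "u \<in> {0..1}"
  shows "Gamma_B B b u (cdf \<nu> x) \<le> 0"
proof -
  have cv: "convex_on {0..1} (\<lambda>u. - B u)" using assms by (simp add: concave_on_def)
  have "- B u - - B (cdf \<nu> x) \<ge> - b (cdf \<nu> x) * (u - cdf \<nu> x)"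
  proof (rule convex_on_imp_above_tangent[OF cv])
    show "cdf \<nu> x \<in> interior {0..1}" using cdf_pos cdf_less_1 by simp
    show "((\<lambda>u. - B u) has_real_derivative - b (cdf \<nu> x)) (at (cdf \<nu> x) within {0..1})"
      by (intro derivative_intros B_deriv cdf_unit is_distribution)
  qed (use u in auto)
  then show ?thesis by (simp add: Gamma_B_def)
qed

end

theorem lemma5p3:
  fixes \<sigma> :: real and B b :: "real \<Rightarrow> real" and \<mu>inf :: "real measure"
  assumes "\<sigma>\<^sup>2 > 0"
    and "\<And>u. u \<in> {0..1} \<Longrightarrow> (B has_real_derivative b u) (at u within {0..1})"
    and "continuous_on {0..1} b"
    and "\<And>u. u \<in> {0..1} \<Longrightarrow> B u \<ge> 0"
    and "B 0 = 0" and "B 1 = 0"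
    and "\<And>u. u \<in> {0<..<1} \<Longrightarrow> B u > 0"
    and "b 0 > 0" and "b 1 < 0"
    and "stationary_measure TYPE('w) \<sigma> b \<mu>inf"
    and "centered \<mu>inf"
  shows "(\<forall>A\<in>orbit_space. \<forall>\<mu>\<in>borel_probs. orbit_map \<mu> = A \<longrightarrow>
            orbit_rate \<sigma> B A =
              relative_entropy \<mu> \<mu>inf
              + ereal (2 / \<sigma>\<^sup>2) * ext_integral lborel (\<lambda>x. Gamma_B B b (cdf \<mu> x) (cdf \<mu>inf x)))
       \<and> (concave_on {0..1} B \<longrightarrow>
            (\<forall>A\<in>orbit_space. orbit_rate \<sigma> B A \<le> orbit_relative_entropy \<mu>inf A))"
proof -
  define c where "c = 2 / \<sigma>\<^sup>2"
  have c: "c > 0" using assms(1) by (simp add: c_def)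
  interpret E: rank_energy B b c
    by unfold_locales (use c assms in auto)
  have \<nu>: "real_distribution \<mu>inf" and int: "integrable \<mu>inf (\<lambda>x. x)"
    and ode: "\<And>x. (cdf \<mu>inf has_real_derivative c * B (cdf \<mu>inf x)) (at x)"
  proof -
    obtain \<Omega> :: "'w measure" and \<beta> X where nd: "nonlinear_diffusion \<sigma> b \<Omega> \<beta> X"
      and st: "\<And>t. t \<ge> 0 \<Longrightarrow> distr \<Omega> borel (X t) = \<mu>inf"
      using assms(10) unfolding stationary_measure_def by blast
    show int: "integrable \<mu>inf (\<lambda>x. x)" using assms(11) by (simp add: centered_def)
    have "prob_space \<Omega>" "X 0 \<in> borel_measurable \<Omega>"
      using nd by (auto simp: nonlinear_diffusion_def brownian_motion_def)
    then have "real_distribution (distr \<Omega> borel (X 0))"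
      by (simp add: real_distribution_def real_distribution_axioms_def prob_space.prob_space_distr)
    then show \<nu>: "real_distribution \<mu>inf" by (simp add: st)
    note gm = E.b_cdf_measurable[OF \<nu>]
    have gb: "\<bar>b (cdf \<mu>inf x)\<bar> \<le> E.K" for x by (rule E.b_bound[OF E.cdf_unit[OF \<nu>]])
    \<comment> \<open>The weak equation is solved for the integral of \<open>h\<close>;
      \<open>c\<close> is the inverse of the diffusion coefficient
      \<open>\<sigma>\<^sup>2 / 2\<close>.\<close>
    have weak: "(\<integral>x. h x \<partial>\<mu>inf) = - c * (\<integral>x. \<psi> x * b (cdf \<mu>inf x) \<partial>\<mu>inf)"
      if "\<And>x. (\<phi> has_real_derivative \<psi> x) (at x)" "\<And>x. (\<psi> has_real_derivative h x) (at x)"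
        "\<And>x. \<bar>\<psi> x\<bar> \<le> C" "\<And>x. \<bar>h x\<bar> \<le> C" "\<And>x y. \<bar>h x - h y\<bar> \<le> C * \<bar>x - y\<bar>"
      for \<phi> \<psi> h :: "real \<Rightarrow> real" and C
      using stationary_weak_equation[OF nd st int gm gb that] assms(1)
      by (simp add: c_def field_simps add_eq_0_iff)
    have I: "measure \<mu>inf {u<..v} = (LBINT y:{u..v}. - c * (\<integral>x. indicator {y<..} x * b (cdf \<mu>inf x) \<partial>\<mu>inf))"
      if "u < v" for u v
      by (rule weak_equation_density[OF \<nu> gm gb weak_equation_interval[OF \<nu> gm gb weak that] that])
    show "(cdf \<mu>inf has_real_derivative c * B (cdf \<mu>inf x)) (at x)" for x
      by (rule E.cdf_ode[OF \<nu> I])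
  qed
  interpret S: stationary_profile B b c \<mu>inf
    by (intro stationary_profile.intro stationary_profile_axioms.intro E.rank_energy_axioms \<nu> int ode)
  have main: "orbit_rate \<sigma> B (orbit_map \<mu>) = relative_entropy \<mu> \<mu>inf
      + ereal c * ext_integral lborel (\<lambda>x. Gamma_B B b (cdf \<mu> x) (cdf \<mu>inf x))"
    if "real_distribution \<mu>" for \<mu>
    unfolding E.orbit_rate_eq[OF that] S.min_free_energy_eq[OF c_def]
    by (rule S.free_energy_decomposition[OF that c_def])
  \<comment> \<open>The identity holds for every representative, while its left-hand side depends on
    the orbit only. Dropping the nonpositive \<open>Gamma_B\<close> term for each representative
    therefore gives a bound by the infimum.\<close>
  have upper: "orbit_rate \<sigma> B A \<le> orbit_relative_entropy \<mu>inf A" if conc: "concave_on {0..1} B" for A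
    unfolding orbit_relative_entropy_def
  proof (rule INF_greatest)
    fix \<mu> assume "\<mu> \<in> {\<mu> \<in> borel_probs. orbit_map \<mu> = A}"
    then have \<mu>: "real_distribution \<mu>" and A: "A = orbit_map \<mu>" by (auto simp: borel_probs_def)
    have "ext_integral lborel (\<lambda>x. Gamma_B B b (cdf \<mu> x) (cdf \<mu>inf x)) \<le> 0"
      by (intro ext_integral_nonpos S.Gamma_nonpos[OF conc] E.cdf_unit[OF \<mu>])
    then have "ereal c * ext_integral lborel (\<lambda>x. Gamma_B B b (cdf \<mu> x) (cdf \<mu>inf x)) \<le> 0"
      using c by (simp add: ereal_zero_le_0_iff ereal_mult_le_0_iff)
    from add_left_mono[OF this, of "relative_entropy \<mu> \<mu>inf"]
    show "orbit_rate \<sigma> B A \<le> relative_entropy \<mu> \<mu>inf" unfolding A main[OF \<mu>] by simp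
  qed
  show ?thesis
    using main upper by (auto simp: borel_probs_def c_def)
qed

end
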